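(* Let $K$ be a field, let $r,s\ge 1$ be integers, $A=K[x_1,\ldots,x_r]$, $B=K[x_{r+1},\ldots,x_{r+s}]$ and $R=K[x_1,\ldots,x_{r+s}]$. Let $I\subset A$ and $J\subset B$ be nonzero proper monomial ideals. Then for all integers $n\ge 0$, $$\operatorname{sdepth}_R\big((I+J)^n/(I+J)^{n+1}\big)\ \ge\ \min_{i+j=n}\big\{\operatorname{sdepth}_A(I^i/I^{i+1})+\operatorname{sdepth}_B(J^j/J^{j+1})\big\},$$ where the minimum is over integers $i,j\ge 0$ with $i+j=n$.
   Context: The symbols $I$, $J$ also denote the extended ideals $IR$, $JR$ in $R$, so $I+J$ means $IR+JR\subset R$. The zeroth power of an ideal is the whole ring. Stanley depth: let $S$ be a polynomial ring over $K$ in $N$ variables $x_1,\ldots,x_N$ and let $M$ be a finitely generated $\mathbb Z^N$-graded $S$-module. A Stanley decomposition of $M$ is a finite direct sum decomposition $\mathcal D: M=\bigoplus_{i=1}^{q} m_iK[Z_i]$ as a $\mathbb Z^N$-graded $K$-vector space, where each $m_i\in M$ is homogeneous, $Z_i\subset\{x_1,\ldots,x_N\}$, and $m_iK[Z_i]=\{um_i: u\in K[Z_i]\}$ is a free $K[Z_i]$-submodule of $M$. Put $\operatorname{sdepth}(\mathcal D)=\min_i|Z_i|$ and let $\operatorname{sdepth}_S(M)$ be the maximum of $\operatorname{sdepth}(\mathcal D)$ over all Stanley decompositions $\mathcal D$ of $M$. *)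

theory Defs
  imports "HOL-Algebra.QuotRing" "HOL-Algebra.Ideal_Product" "HOL-Algebra.Module"
    "HOL-Library.Poly_Mapping"
begin

text \<open>
  Polynomials over \<open>'k\<close> in the variables \<open>x\<^sub>i\<close> with \<open>i\<close> a natural number: a polynomial maps exponent
  vectors to coefficients. For a set \<open>V\<close> of indices, \<open>poly_ring V\<close> is the subring \<open>K[x\<^sub>i : i \<in> V]\<close>, so
  that \<open>A\<close> and \<open>B\<close> are literally subrings of \<open>R\<close>.
\<close>

type_synonym 'k mpoly = "(nat \<Rightarrow>\<^sub>0 nat) \<Rightarrow>\<^sub>0 'k"

definition poly_ring :: "nat set \<Rightarrow> 'k::field mpoly ring" where
  "poly_ring V =
     \<lparr>carrier = {p. \<forall>a \<in> Poly_Mapping.keys p. Poly_Mapping.keys a \<subseteq> V},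
      mult = (*), one = 1, zero = 0, add = (+)\<rparr>"

definition monomials :: "nat set \<Rightarrow> 'k::field mpoly set" where
  "monomials V = {Poly_Mapping.single a 1 | a. Poly_Mapping.keys a \<subseteq> V}"

definition monomial_ideal :: "nat set \<Rightarrow> 'k::field mpoly set \<Rightarrow> bool" where
  "monomial_ideal V I \<longleftrightarrow> (\<exists>G \<subseteq> monomials V. I = Idl\<^bsub>poly_ring V\<^esub> G)"

text \<open>
  For ideals \<open>L' \<subseteq> L\<close> of \<open>S\<close>, the \<open>S\<close>-module \<open>L/L'\<close>: its elements are the cosets of \<open>L'\<close> that lie in
  \<open>L\<close>, with the operations of the factor ring \<open>S Quot L'\<close>. The ring multiplication and unit
  are present only because modules are records extending rings; they play no role.
\<close>

definition quot_module :: "'a ring \<Rightarrow> 'a set \<Rightarrow> 'a set \<Rightarrow> ('a, 'a set) module" where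
  "quot_module S L L' =
     \<lparr>carrier = (\<lambda>p. L' +>\<^bsub>S\<^esub> p) ` L,
      mult = rcoset_mult S L', one = L' +>\<^bsub>S\<^esub> \<one>\<^bsub>S\<^esub>,
      zero = L', add = set_add S,
      smult = (\<lambda>u C. rcoset_mult S L' (L' +>\<^bsub>S\<^esub> u) C)\<rparr>"

text \<open>
  The component of \<open>L/L'\<close> in degree \<open>d\<close>: the classes of the elements of \<open>L\<close> all of whose terms have
  exponent vector \<open>d\<close>. It is \<open>{0}\<close> if \<open>d\<close> has a negative entry.
\<close>

definition quot_grading ::
  "'k::field mpoly ring \<Rightarrow> 'k mpoly set \<Rightarrow> 'k mpoly set \<Rightarrow> (nat \<Rightarrow>\<^sub>0 int) \<Rightarrow> 'k mpoly set set" where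
  "quot_grading S L L' d =
     {L' +>\<^bsub>S\<^esub> p | p. p \<in> L \<and>
        (\<forall>a \<in> Poly_Mapping.keys p. \<forall>i. int (Poly_Mapping.lookup a i) = Poly_Mapping.lookup d i)}"

text \<open>
  In the following, \<open>M\<close> is a finitely generated module over \<open>poly_ring V\<close>, with \<open>V\<close> finite, and
  \<open>gr d\<close> is its component in degree \<open>d\<close>, for \<open>d \<in> \<int>\<^sup>V\<close> (finitely supported integer vectors
  with support in \<open>V\<close>).
\<close>

definition homogeneous :: "nat set \<Rightarrow> ((nat \<Rightarrow>\<^sub>0 int) \<Rightarrow> 'm set) \<Rightarrow> 'm \<Rightarrow> bool" where
  "homogeneous V gr m \<longleftrightarrow> (\<exists>d. Poly_Mapping.keys d \<subseteq> V \<and> m \<in> gr d)"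

definition stanley_space :: "('k::field mpoly, 'm) module \<Rightarrow> 'm \<Rightarrow> nat set \<Rightarrow> 'm set" where
  "stanley_space M m Z = {u \<odot>\<^bsub>M\<^esub> m | u. u \<in> carrier (poly_ring Z)}"

text \<open>
  A decomposition is a finite list of pairs \<open>(m\<^sub>i, Z\<^sub>i)\<close>. The injectivity condition says that
  \<open>m\<^sub>i K[Z\<^sub>i]\<close> is free over \<open>K[Z\<^sub>i]\<close> with basis \<open>m\<^sub>i\<close>. The last condition says that \<open>M\<close> is the direct sum
  of the \<open>m\<^sub>i K[Z\<^sub>i]\<close>; the summands are automatically graded subspaces, the \<open>m\<^sub>i\<close> being homogeneous.
\<close>

definition stanley_decomposition ::
  "nat set \<Rightarrow> ('k::field mpoly, 'm) module \<Rightarrow> ((nat \<Rightarrow>\<^sub>0 int) \<Rightarrow> 'm set) \<Rightarrow> ('m \<times> nat set) list \<Rightarrow> bool"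
where
  "stanley_decomposition V M gr D \<longleftrightarrow>
     (\<forall>(m, Z) \<in> set D. m \<in> carrier M \<and> homogeneous V gr m \<and> Z \<subseteq> V \<and>
        inj_on (\<lambda>u. u \<odot>\<^bsub>M\<^esub> m) (carrier (poly_ring Z))) \<and>
     (\<forall>x \<in> carrier M. \<exists>!f.
        f \<in> (\<Pi>\<^sub>E i \<in> {..<length D}. stanley_space M (fst (D ! i)) (snd (D ! i))) \<and>
        x = (\<Oplus>\<^bsub>M\<^esub> i \<in> {..<length D}. f i))"

definition sdepth_of_decomposition :: "('m \<times> nat set) list \<Rightarrow> nat" where
  "sdepth_of_decomposition D = Min {card Z | m Z. (m, Z) \<in> set D}"

text \<open>
  For \<open>V\<close> finite and \<open>M\<close> nonzero the maximum is over a subset of \<open>{0..card V}\<close>. The value for the zero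
  module, whose only decomposition is the empty one, is unspecified.
\<close>

definition sdepth ::
  "nat set \<Rightarrow> ('k::field mpoly, 'm) module \<Rightarrow> ((nat \<Rightarrow>\<^sub>0 int) \<Rightarrow> 'm set) \<Rightarrow> nat" where
  "sdepth V M gr = Max {sdepth_of_decomposition D | D. stanley_decomposition V M gr D}"

definition sdepth_quot :: "nat set \<Rightarrow> 'k::field mpoly set \<Rightarrow> 'k mpoly set \<Rightarrow> nat" where
  "sdepth_quot V L L' =
     sdepth V (quot_module (poly_ring V) L L') (quot_grading (poly_ring V) L L')"

text \<open>
  Powers of ideals are taken in the monoid of ideals, whose unit is the whole ring.
\<close>

definition ideal_power :: "'a ring \<Rightarrow> 'a set \<Rightarrow> nat \<Rightarrow> 'a set" where
  "ideal_power S I n = I [^]\<^bsub>ideals_set S\<^esub> n"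

definition extended_sum :: "'a ring \<Rightarrow> 'a set \<Rightarrow> 'a set \<Rightarrow> 'a set" where
  "extended_sum S I J = (Idl\<^bsub>S\<^esub> I) <+>\<^bsub>S\<^esub> (Idl\<^bsub>S\<^esub> J)"

end

theory Submission
  imports Defs "HOL-Library.Set_Algebras" "HOL-Library.Disjoint_Sets"
begin

text \<open>
  For monomial ideals \<open>L' \<subseteq> L\<close> with exponent sets \<open>E' \<subseteq> E\<close>, a Stanley decomposition of \<open>L/L'\<close> is the
  same as a partition of \<open>E - E'\<close> into finitely many cones \<open>d + \<nat>\<^sup>Z\<close>, so the depths can be compared on
  exponent vectors. Every vector of \<open>\<nat>\<^sup>r\<^sup>+\<^sup>s\<close> is uniquely \<open>a + b\<close> with \<open>a\<close> supported on the first and \<open>b\<close> on the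
  second block of variables, and \<open>x\<^sup>a\<^sup>+\<^sup>b\<close> lies in \<open>(I + J)\<^sup>n\<close> but not in the next power exactly if there
  are \<open>i + j = n\<close> such that \<open>x\<^sup>a\<close> contributes to \<open>I\<^sup>i/I\<^sup>i\<^sup>+\<^sup>1\<close> and \<open>x\<^sup>b\<close> to \<open>J\<^sup>j/J\<^sup>j\<^sup>+\<^sup>1\<close>. Adding cones pairwise
  turns optimal partitions for these quotients into one for \<open>(I + J)\<^sup>n/(I + J)\<^sup>n\<^sup>+\<^sup>1\<close>.
\<close>

section \<open>Partitions of sets of exponent vectors into cones\<close>

definition exps :: "nat set \<Rightarrow> (nat \<Rightarrow>\<^sub>0 nat) set" where
  "exps V = {a. Poly_Mapping.keys a \<subseteq> V}"

text \<open>Kept polymorphic because it cuts down two kinds of objects: exponent vectors to a block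
  of variables, and polynomials to a set of exponents.\<close>

definition restrict_pm :: "'a set \<Rightarrow> ('a \<Rightarrow>\<^sub>0 'b::zero) \<Rightarrow> ('a \<Rightarrow>\<^sub>0 'b)" where
  "restrict_pm S p = Poly_Mapping.mapp (\<lambda>k c. c when k \<in> S) p"

lemma lookup_restrict_pm:
  "Poly_Mapping.lookup (restrict_pm S p) k = (Poly_Mapping.lookup p k when k \<in> S)"
  by (auto simp: restrict_pm_def lookup_mapp when_def in_keys_iff)

lemma keys_restrict_pm: "Poly_Mapping.keys (restrict_pm S p) = Poly_Mapping.keys p \<inter> S"
  by (auto simp: in_keys_iff lookup_restrict_pm)

lemma in_exps_iff: "a \<in> exps V \<longleftrightarrow> (\<forall>i. i \<notin> V \<longrightarrow> Poly_Mapping.lookup a i = 0)"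
  by (auto simp: exps_def in_keys_iff)

lemma zero_in_exps [simp]: "0 \<in> exps V"
  by (simp add: exps_def)

lemma add_in_exps_iff: "a + b \<in> exps V \<longleftrightarrow> a \<in> exps V \<and> b \<in> exps V"
  by (auto simp: in_exps_iff lookup_add)

lemma exps_mono: "V \<subseteq> W \<Longrightarrow> exps V \<subseteq> exps W"
  by (auto simp: exps_def)

lemma exps_empty: "exps {} = {0}"
  by (auto simp: exps_def)

lemma exps_Un: "exps (V \<union> W) = exps V + exps W"
proof
  show "exps (V \<union> W) \<subseteq> exps V + exps W"
  proof
    fix a assume a: "a \<in> exps (V \<union> W)"
    have "a = restrict_pm V a + restrict_pm (-V) a"
      by (rule poly_mapping_eqI) (auto simp: lookup_add lookup_restrict_pm when_def)
    moreover have "restrict_pm V a \<in> exps V" "restrict_pm (-V) a \<in> exps W"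
      using a by (auto simp: exps_def keys_restrict_pm)
    ultimately show "a \<in> exps V + exps W"
      using set_plus_intro by metis
  qed
  show "exps V + exps W \<subseteq> exps (V \<union> W)"
    using exps_mono[of V "V \<union> W"] exps_mono[of W "V \<union> W"]
    by (auto simp: set_plus_def add_in_exps_iff)
qed

lemma exps_add_self: "exps V + exps V = exps V"
  by (simp flip: exps_Un)

text \<open>Outside \<open>V\<close> both \<open>a\<close> and \<open>a'\<close> vanish, and on
  \<open>V\<close> both \<open>b\<close> and \<open>b'\<close> vanish, so each coordinate of the sum
  reads off one summand.\<close>

lemma exps_add_unique:
  assumes "a + b = a' + b'" "a \<in> exps V" "a' \<in> exps V" "b \<in> exps W" "b' \<in> exps W" "V \<inter> W = {}"
  shows "a = a'" "b = b'"
proof -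
  have eq: "Poly_Mapping.lookup a i + Poly_Mapping.lookup b i
      = Poly_Mapping.lookup a' i + Poly_Mapping.lookup b' i" for i
    using assms(1) by (metis lookup_add)
  show "a = a'"
  proof (rule poly_mapping_eqI)
    fix i show "Poly_Mapping.lookup a i = Poly_Mapping.lookup a' i"
    proof (cases "i \<in> V")
      case True
      then have "i \<notin> W" using assms(6) by blast
      then show ?thesis using eq[of i] assms(4,5) by (simp add: in_exps_iff)
    next
      case False
      then show ?thesis using assms(2,3) by (simp add: in_exps_iff)
    qed
  qed
  then show "b = b'" using assms(1) by simp
qed

section \<open>Exponent ideals, cones and cone partitions\<close>

text \<open>These are the exponent sets of monomial ideals of \<open>poly_ring V\<close>. The empty
  set qualifies and stands for the zero ideal.\<close>

definition exp_ideal :: "nat set \<Rightarrow> (nat \<Rightarrow>\<^sub>0 nat) set \<Rightarrow> bool" where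
  "exp_ideal V E \<longleftrightarrow> E \<subseteq> exps V \<and> E + exps V \<subseteq> E"

lemma exp_ideal_add: "exp_ideal V E \<Longrightarrow> a \<in> E \<Longrightarrow> b \<in> exps V \<Longrightarrow> a + b \<in> E"
  unfolding exp_ideal_def by blast

definition cone :: "(nat \<Rightarrow>\<^sub>0 nat) \<times> nat set \<Rightarrow> (nat \<Rightarrow>\<^sub>0 nat) set" where
  "cone c = fst c +o exps (snd c)"

lemma fst_in_cone: "fst c \<in> cone c"
  using set_plus_intro2[of 0 "exps (snd c)" "fst c"] by (simp add: cone_def)

lemma cone_add: "cone (d + e, Z \<union> U) = cone (d, Z) + cone (e, U)"
  by (simp add: cone_def exps_Un set_plus_rearrange)

text \<open>A set of pairs can replace the list of a Stanley decomposition: every cone contains its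
  apex, so a repeated cone would violate disjointness.\<close>

definition cone_partition ::
  "nat set \<Rightarrow> (nat \<Rightarrow>\<^sub>0 nat) set \<Rightarrow> ((nat \<Rightarrow>\<^sub>0 nat) \<times> nat set) set \<Rightarrow> bool" where
  "cone_partition V X P \<longleftrightarrow> finite P \<and> (\<forall>c\<in>P. snd c \<subseteq> V) \<and>
     disjoint_family_on cone P \<and> (\<Union>c\<in>P. cone c) = X"

lemma cone_partitionD:
  assumes "cone_partition V X P"
  shows "finite P" "\<And>c. c \<in> P \<Longrightarrow> snd c \<subseteq> V" "\<And>c. c \<in> P \<Longrightarrow> cone c \<subseteq> X"
    "\<And>c c'. c \<in> P \<Longrightarrow> c' \<in> P \<Longrightarrow> c \<noteq> c' \<Longrightarrow> cone c \<inter> cone c' = {}"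
    "(\<Union>c\<in>P. cone c) = X"
  using assms by (auto simp: cone_partition_def disjoint_family_on_def)

text \<open>Two cones from the same piece are disjoint by the partition of that piece, two from
  different pieces because the pieces are.\<close>

lemma cone_partition_UN:
  assumes "finite I" "\<And>i. i \<in> I \<Longrightarrow> cone_partition V (X i) (P i)" "disjoint_family_on X I"
  shows "cone_partition V (\<Union>i\<in>I. X i) (\<Union>i\<in>I. P i)"
proof -
  have "cone c \<inter> cone c' = {}"
    if "i \<in> I" "j \<in> I" "c \<in> P i" "c' \<in> P j" "c \<noteq> c'" for i j c c'
  proof (cases "i = j")
    case True
    then show ?thesis
      using assms(2)[of i] that unfolding cone_partition_def disjoint_family_on_def by blast
  next
    case False
    then have "X i \<inter> X j = {}" using assms(3) that by (auto simp: disjoint_family_on_def)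
    then show ?thesis using assms(2) that unfolding cone_partition_def by blast
  qed
  then have "disjoint_family_on cone (\<Union>i\<in>I. P i)"
    unfolding disjoint_family_on_def by blast
  moreover have "(\<Union>c\<in>(\<Union>i\<in>I. P i). cone c) = (\<Union>i\<in>I. X i)"
    using assms(2) by (simp add: cone_partition_def)
  moreover have "finite (\<Union>i\<in>I. P i)" "\<forall>c\<in>(\<Union>i\<in>I. P i). snd c \<subseteq> V"
    using assms(1,2) by (auto simp: cone_partition_def)
  ultimately show ?thesis
    by (simp only: cone_partition_def)
qed

text \<open>The sum of two cones is a cone on the union of their variable sets. Since a vector
  splits uniquely along \<open>V\<close> and \<open>W\<close>, a common point of two such sums would
  give common points in both factors.\<close>

lemma cone_partition_plus:
  assumes P: "cone_partition V X P" and Q: "cone_partition W Y Q"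
    and sub: "X \<subseteq> exps V" "Y \<subseteq> exps W" and "V \<inter> W = {}"
  shows "cone_partition (V \<union> W) (X + Y) ((\<lambda>(c, c'). (fst c + fst c', snd c \<union> snd c')) ` (P \<times> Q))"
    (is "cone_partition _ _ (?f ` _)")
proof -
  have cone_f: "cone (?f (c, c')) = cone c + cone c'" for c c'
    using cone_add[of "fst c" "fst c'" "snd c" "snd c'"] by simp
  have in_P: "cone c \<subseteq> exps V" if "c \<in> P" for c
    using P sub that unfolding cone_partition_def by blast
  have in_Q: "cone c \<subseteq> exps W" if "c \<in> Q" for c
    using Q sub that unfolding cone_partition_def by blast
  have "cone (?f x) \<inter> cone (?f y) = {}" if xy: "x \<in> P \<times> Q" "y \<in> P \<times> Q" "x \<noteq> y" for x y
  proof (rule ccontr)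
    obtain c c' e e' where x: "x = (c, c')" and y: "y = (e, e')" by (metis surj_pair)
    assume "cone (?f x) \<inter> cone (?f y) \<noteq> {}"
    then obtain a a' b b' where *: "a + a' = b + b'" "a \<in> cone c" "a' \<in> cone c'"
        "b \<in> cone e" "b' \<in> cone e'"
      unfolding x y cone_f by (force elim!: set_plus_elim)
    have "a = b" "a' = b'"
      using exps_add_unique[OF *(1), of V W] * in_P in_Q xy assms(5) unfolding x y by blast+
    then have "c = e" "c' = e'"
      using P Q xy * unfolding x y cone_partition_def disjoint_family_on_def by blast+
    then show False using xy x y by simp
  qed
  then have "disjoint_family_on cone (?f ` (P \<times> Q))"
    unfolding disjoint_family_on_def by blast
  moreover have "(\<Union>c\<in>?f ` (P \<times> Q). cone c) = (\<Union>c\<in>P. cone c) + (\<Union>c\<in>Q. cone c)"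
    using cone_f by (fastforce simp: set_plus_def)
  moreover have "snd c \<subseteq> V \<union> W" if "c \<in> ?f ` (P \<times> Q)" for c
    using that P Q unfolding cone_partition_def by fastforce
  ultimately show ?thesis
    using P Q unfolding cone_partition_def by blast
qed

text \<open>
  Induction on the number of variables: the slices of an ideal at height \<open>k\<close> in the last variable
  increase with \<open>k\<close>. Their union has a finite partition by the induction hypothesis, hence is finitely
  generated, so the slices are constant from some height \<open>K\<close> on. (This avoids Dickson's lemma.)
\<close>

lemma cone_partition_exists:
  assumes "finite V" "exp_ideal V E" "exp_ideal V E'"
  shows "\<exists>P. cone_partition V (E - E') P"
  using assms
proof (induction V arbitrary: E E' rule: finite_induct)
  case empty
  then have "E - E' = {} \<or> E - E' = {0}"
    by (auto simp: exp_ideal_def exps_empty)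
  then show ?case
  proof
    assume "E - E' = {}"
    then have "cone_partition {} (E - E') {}" by (simp add: cone_partition_def disjoint_family_on_def)
    then show ?thesis ..
  next
    assume "E - E' = {0}"
    then have "cone_partition {} (E - E') {(0, {})}"
      by (simp add: cone_partition_def disjoint_family_on_def cone_def exps_empty)
    then show ?thesis ..
  qed
next
  case (insert v W)
  define slice where "slice F k = {a \<in> exps W. a + Poly_Mapping.single v k \<in> F}" for F k
  have single_v: "Poly_Mapping.single v k \<in> exps {v}" for k
    by (simp add: exps_def)
  have W_sub: "exps W \<subseteq> exps (insert v W)" "exps {v} \<subseteq> exps (insert v W)"
    by (intro exps_mono; blast)+
  have slice_ideal: "exp_ideal W (slice F k)" if F: "exp_ideal (insert v W) F" for F k
  proof -
    have "a + b \<in> slice F k" if "a \<in> slice F k" "b \<in> exps W" for a b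
    proof -
      have "a + Poly_Mapping.single v k + b \<in> F"
        using exp_ideal_add[OF F] that W_sub unfolding slice_def by blast
      then show ?thesis using that by (simp add: slice_def ac_simps add_in_exps_iff)
    qed
    then show ?thesis unfolding exp_ideal_def by (auto simp: slice_def elim!: set_plus_elim)
  qed
  have slice_mono: "slice F k \<subseteq> slice F l" if F: "exp_ideal (insert v W) F" and "k \<le> l" for F k l
  proof
    fix a assume a: "a \<in> slice F k"
    have "a + Poly_Mapping.single v k + Poly_Mapping.single v (l - k) \<in> F"
      using a exp_ideal_add[OF F] single_v W_sub unfolding slice_def by blast
    moreover have "Poly_Mapping.single v k + Poly_Mapping.single v (l - k) = Poly_Mapping.single v l"
      using \<open>k \<le> l\<close> by (simp flip: single_add)
    ultimately show "a \<in> slice F l" using a by (simp add: slice_def add.assoc)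
  qed
  have stable: "\<exists>k. \<forall>l\<ge>k. slice F l = slice F k" if F: "exp_ideal (insert v W) F" for F
  proof -
    have "exp_ideal W (\<Union>k. slice F k)"
      using slice_ideal[OF F] unfolding exp_ideal_def by (fastforce elim!: set_plus_elim)
    moreover have "exp_ideal W {}" by (simp add: exp_ideal_def)
    \<comment> \<open>The induction hypothesis is applied to the union of the slices with the empty
      set as the smaller ideal.\<close>
    ultimately obtain P where P: "cone_partition W (\<Union>k. slice F k) P"
      using insert.IH by (metis Diff_empty)
    have "\<forall>c\<in>P. \<exists>k. fst c \<in> slice F k"
      using P fst_in_cone unfolding cone_partition_def by blast
    then obtain h where h: "\<And>c. c \<in> P \<Longrightarrow> fst c \<in> slice F (h c)" by metis
    have fin: "finite P" using P by (simp add: cone_partition_def)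
    \<comment> \<open>The apexes of the cones generate the union of the slices, and all of them have
      appeared by height \<open>k\<close>. The inserted \<open>0\<close> covers an empty
      \<open>P\<close>.\<close>
    define k where "k = Max (insert 0 (h ` P))"
    have "a \<in> slice F k" if "a \<in> slice F l" for a l
    proof -
      have "a \<in> (\<Union>c\<in>P. cone c)"
        using that P by (auto simp: cone_partition_def)
      then obtain c b where c: "c \<in> P" "a = fst c + b" "b \<in> exps (snd c)"
        by (auto simp: cone_def elt_set_plus_def)
      have "snd c \<subseteq> W" using c P by (simp add: cone_partition_def)
      then have "b \<in> exps W" using c exps_mono by blast
      moreover have "h c \<le> k" unfolding k_def using fin c by simp
      ultimately show ?thesis
        using c h[of c] slice_mono[OF F] exp_ideal_add[OF slice_ideal[OF F]] by blast
    qed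
    then have "\<forall>l\<ge>k. slice F l = slice F k" using slice_mono[OF F] by blast
    then show ?thesis ..
  qed
  obtain k k' where k: "\<And>l. l \<ge> k \<Longrightarrow> slice E l = slice E k"
    and k': "\<And>l. l \<ge> k' \<Longrightarrow> slice E' l = slice E' k'"
    using stable insert.prems by meson
  define K where "K = max k k'"
  \<comment> \<open>Both sequences of slices are constant from \<open>K\<close> on, so truncating
    the height at \<open>K\<close> changes no slice.\<close>
  have K: "slice E (min m K) = slice E m" "slice E' (min m K) = slice E' m" for m
    using k[of m] k[of K] k'[of m] k'[of K] unfolding K_def by (auto simp: min_def max_def)
  \<comment> \<open>The heights that truncate to \<open>m\<close>: only \<open>m\<close> itself if
    \<open>m < K\<close>, and all heights from \<open>K\<close> up if \<open>m = K\<close>. Either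
    way they form a single cone in direction \<open>v\<close>.\<close>
  define T where "T m = {Poly_Mapping.single v l | l. min l K = m}" for m
  have T: "cone_partition {v} (T m) {(Poly_Mapping.single v m, if m < K then {} else {v})}"
    if m: "m \<le> K" for m
  proof -
    have "cone (Poly_Mapping.single v m, if m < K then {} else {v}) = T m"
    proof (cases "m < K")
      case True
      then have "T m = {Poly_Mapping.single v m}" by (auto simp: T_def min_def)
      then show ?thesis using True by (auto simp: cone_def exps_empty elt_set_plus_def)
    next
      case False
      have "exps {v} = {Poly_Mapping.single v l | l. True}"
      proof safe
        fix a assume "a \<in> exps {v}"
        then have "a = Poly_Mapping.single v (Poly_Mapping.lookup a v)"
          by (intro poly_mapping_eqI) (auto simp: in_exps_iff lookup_single when_def)
        then show "\<exists>l. a = Poly_Mapping.single v l \<and> True" by blast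
      qed (rule single_v)
      moreover have "T m = {Poly_Mapping.single v (m + l) | l. True}"
        using False m by (auto simp: T_def min_def intro: le_Suc_ex)
          (metis le_Suc_ex nle_le)+
      ultimately show ?thesis using False
        by (auto simp: cone_def elt_set_plus_def single_add)
    qed
    then show ?thesis by (simp add: cone_partition_def disjoint_family_on_def)
  qed
  have T_sub: "T m \<subseteq> exps {v}" for m using single_v by (auto simp: T_def)
  \<comment> \<open>The part of \<open>E - E'\<close> whose truncated height is \<open>m\<close>;
    there the slice does not vary, so it is a sum of a set on \<open>W\<close> and a cone on
    \<open>{v}\<close>.\<close>
  define X where "X m = (slice E m - slice E' m) + T m" for m
  have "\<exists>P. cone_partition (insert v W) (X m) P" if "m \<le> K" for m
  proof -
    obtain P where "cone_partition W (slice E m - slice E' m) P"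
      using insert.IH slice_ideal insert.prems by metis
    from cone_partition_plus[OF this T[OF that] _ T_sub] show ?thesis
      using insert.hyps unfolding X_def by (auto simp: slice_def)
  qed
  then obtain P where P: "\<And>m. m \<in> {..K} \<Longrightarrow> cone_partition (insert v W) (X m) (P m)"
    by (metis atMost_iff)
  \<comment> \<open>Within \<open>E - E'\<close> the truncated height alone decides the layer. This
    yields both the disjointness of the layers and the fact that they cover
    \<open>E - E'\<close>.\<close>
  have X_iff: "a + Poly_Mapping.single v l \<in> X m \<longleftrightarrow>
      min l K = m \<and> a + Poly_Mapping.single v l \<in> E - E'" if a: "a \<in> exps W" for a l m
  proof
    assume "a + Poly_Mapping.single v l \<in> X m"
    then obtain b l' where b: "b \<in> slice E m - slice E' m" "min l' K = m"
        "a + Poly_Mapping.single v l = b + Poly_Mapping.single v l'"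
      unfolding X_def T_def by (auto elim!: set_plus_elim)
    have "a = b" "Poly_Mapping.single v l = Poly_Mapping.single v l'"
      using exps_add_unique[OF b(3), of W "{v}"] a b single_v insert.hyps by (auto simp: slice_def)
    moreover from this(2) have "l = l'" by (metis lookup_single_eq)
    ultimately show "min l K = m \<and> a + Poly_Mapping.single v l \<in> E - E'"
      using b K[of l] a by (auto simp: slice_def)
  next
    assume "min l K = m \<and> a + Poly_Mapping.single v l \<in> E - E'"
    then show "a + Poly_Mapping.single v l \<in> X m"
      using K[of l] a by (auto simp: X_def T_def slice_def)
  qed
  have decomp: "\<exists>a\<in>exps W. \<exists>l. x = a + Poly_Mapping.single v l" if "x \<in> exps (insert v W)" for x
  proof -
    have "x = restrict_pm (- {v}) x + Poly_Mapping.single v (Poly_Mapping.lookup x v)"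
      by (rule poly_mapping_eqI) (auto simp: lookup_add lookup_restrict_pm lookup_single when_def)
    moreover have "restrict_pm (- {v}) x \<in> exps W"
      using that by (auto simp: exps_def keys_restrict_pm)
    ultimately show ?thesis by blast
  qed
  have X_sub: "X m \<subseteq> exps (insert v W)" for m
  proof -
    have "X m \<subseteq> exps W + exps {v}"
      unfolding X_def using T_sub by (intro set_plus_mono2) (auto simp: slice_def)
    then show ?thesis using exps_Un[of W "{v}"] by simp
  qed
  have "m = m'" if x: "x \<in> X m" "x \<in> X m'" for x m m'
  proof -
    obtain a l where al: "a \<in> exps W" "x = a + Poly_Mapping.single v l"
      using decomp[of x] X_sub[of m] x by blast
    show ?thesis using x X_iff[OF al(1), of l] unfolding al(2) by simp
  qed
  then have "disjoint_family_on X {..K}"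
    unfolding disjoint_family_on_def by blast
  moreover have "(\<Union>m\<in>{..K}. X m) = E - E'"
  proof -
    have "x \<in> (\<Union>m\<in>{..K}. X m) \<longleftrightarrow> x \<in> E - E'" if x: "x \<in> exps (insert v W)" for x
      using decomp[OF x] X_iff by auto
    moreover have "E - E' \<subseteq> exps (insert v W)"
      using insert.prems by (auto simp: exp_ideal_def)
    ultimately show ?thesis using X_sub by blast
  qed
  ultimately show ?case
    using cone_partition_UN[of "{..K}" _ X P] P by (metis finite_atMost)
qed

section \<open>The depth of a set of exponent vectors\<close>

definition partition_sdepth :: "nat set \<Rightarrow> (nat \<Rightarrow>\<^sub>0 nat) set \<Rightarrow> nat" where
  "partition_sdepth V X = Max {Min (card ` snd ` P) | P. cone_partition V X P}"

text \<open>A partition of a nonempty set contains some cone, whose number of variables is at most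
  \<open>card V\<close> and bounds the minimum from above. This gives access to
  \<open>Max\<close>.\<close>

lemma finite_partition_depths:
  assumes "finite V" "X \<noteq> {}"
  shows "finite {Min (card ` snd ` P) | P. cone_partition V X P}"
proof (rule finite_subset)
  show "{Min (card ` snd ` P) | P. cone_partition V X P} \<subseteq> {..card V}"
  proof clarsimp
    fix P assume P: "cone_partition V X P"
    then obtain c where c: "c \<in> P" using assms by (auto simp: cone_partition_def)
    have "Min (card ` snd ` P) \<le> card (snd c)"
      using P c by (intro Min_le) (auto simp: cone_partition_def)
    also have "\<dots> \<le> card V" using P c assms by (auto simp: cone_partition_def intro: card_mono)
    finally show "Min (card ` snd ` P) \<le> card V" .
  qed
qed simp

lemma partition_sdepth_ge:
  assumes "finite V" "X \<noteq> {}" "cone_partition V X P" "\<And>c. c \<in> P \<Longrightarrow> k \<le> card (snd c)"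
  shows "k \<le> partition_sdepth V X"
proof -
  have "P \<noteq> {}" "finite P" using assms(2,3) by (auto simp: cone_partition_def)
  then have "k \<le> Min (card ` snd ` P)" using assms(4) by simp
  also have "\<dots> \<le> partition_sdepth V X"
    unfolding partition_sdepth_def using finite_partition_depths[OF assms(1,2)] assms(3)
    by (intro Max_ge) auto
  finally show ?thesis .
qed

lemma partition_sdepth_attained:
  assumes "finite V" "X \<noteq> {}" "\<exists>P. cone_partition V X P"
  obtains P where "cone_partition V X P" "\<And>c. c \<in> P \<Longrightarrow> partition_sdepth V X \<le> card (snd c)"
proof -
  have "partition_sdepth V X \<in> {Min (card ` snd ` P) | P. cone_partition V X P}"
    unfolding partition_sdepth_def
    using finite_partition_depths[OF assms(1,2)] assms(3) by (intro Max_in) auto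
  then obtain P where "cone_partition V X P" "partition_sdepth V X = Min (card ` snd ` P)" by blast
  moreover have "Min (card ` snd ` P) \<le> card (snd c)" if "c \<in> P" for c
    using calculation that by (intro Min_le) (auto simp: cone_partition_def)
  ultimately show thesis using that by metis
qed

section \<open>Monomial ideals\<close>

text \<open>Allowing an arbitrary set of exponents lets the same notion describe rings, monomial
  ideals and the representatives of a Stanley space.\<close>

definition poly_span :: "(nat \<Rightarrow>\<^sub>0 nat) set \<Rightarrow> 'k::field mpoly set" where
  "poly_span E = {p. Poly_Mapping.keys p \<subseteq> E}"

lemma poly_ring_simps [simp]:
  "carrier (poly_ring V) = poly_span (exps V)"
  "mult (poly_ring V) = (*)" "one (poly_ring V) = 1"
  "zero (poly_ring V) = 0" "add (poly_ring V) = (+)"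
  by (auto simp: poly_ring_def poly_span_def exps_def)

lemma poly_span_iff: "p \<in> poly_span E \<longleftrightarrow> (\<forall>a. a \<notin> E \<longrightarrow> Poly_Mapping.lookup p a = 0)"
  by (auto simp: poly_span_def in_keys_iff)

lemma zero_in_poly_span [simp]: "0 \<in> poly_span E"
  by (simp add: poly_span_iff)

lemma poly_span_add: "p \<in> poly_span E \<Longrightarrow> q \<in> poly_span E \<Longrightarrow> p + q \<in> poly_span E"
  by (simp add: poly_span_iff lookup_add)

lemma poly_span_uminus: "p \<in> poly_span E \<Longrightarrow> - p \<in> poly_span E"
  by (simp add: poly_span_iff)

lemma poly_span_sum: "(\<And>i. i \<in> A \<Longrightarrow> f i \<in> poly_span E) \<Longrightarrow> sum f A \<in> poly_span E"
  by (simp add: poly_span_iff lookup_sum)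

lemma poly_span_mult: "p \<in> poly_span E \<Longrightarrow> q \<in> poly_span F \<Longrightarrow> p * q \<in> poly_span (E + F)"
  using keys_mult[of p q] unfolding poly_span_def by blast

lemma poly_span_mono: "E \<subseteq> F \<Longrightarrow> poly_span E \<subseteq> poly_span F"
  by (auto simp: poly_span_def)

lemma single_in_poly_span: "a \<in> E \<Longrightarrow> Poly_Mapping.single a c \<in> poly_span E"
  by (simp add: poly_span_def)

lemma single_one_in_poly_span_iff:
  "Poly_Mapping.single a 1 \<in> (poly_span E :: 'k::field mpoly set) \<longleftrightarrow> a \<in> E"
  by (simp add: poly_span_def)

lemma poly_span_expand: "p = (\<Sum>a\<in>Poly_Mapping.keys p. Poly_Mapping.single a (Poly_Mapping.lookup p a))"
  by (rule poly_mapping_eqI) (auto simp: lookup_sum lookup_single when_def in_keys_iff)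

text \<open>In the convolution only the right exponent \<open>d\<close> contributes, and
  cancellation then forces the left exponent to be \<open>b\<close>.\<close>

lemma lookup_times_single:
  fixes p :: "'k::field mpoly"
  shows "Poly_Mapping.lookup (p * Poly_Mapping.single d c) (b + d) = Poly_Mapping.lookup p b * c"
proof -
  have inner: "(\<Sum>q. (Poly_Mapping.lookup (Poly_Mapping.single d c) q when b + d = l + q)) = (c when l = b)" for l
  proof -
    have "(\<Sum>q. (Poly_Mapping.lookup (Poly_Mapping.single d c) q when b + d = l + q))
        = (\<Sum>q. ((c when l = b) when q = d))"
      by (rule Sum_any.cong) (auto simp: lookup_single when_def)
    then show ?thesis by simp
  qed
  have "Poly_Mapping.lookup (p * Poly_Mapping.single d c) (b + d)
      = (\<Sum>l. Poly_Mapping.lookup p l * (c when l = b))"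
    by (simp only: lookup_mult inner)
  also have "\<dots> = (\<Sum>l. (Poly_Mapping.lookup p l * c when l = b))"
    by (rule Sum_any.cong) (auto simp: when_def)
  finally show ?thesis by simp
qed

lemma cring_poly_ring: "cring (poly_ring V :: 'k::field mpoly ring)"
proof (rule cringI)
  show "abelian_group (poly_ring V :: 'k mpoly ring)"
  proof (rule abelian_groupI)
    fix x :: "'k mpoly" assume "x \<in> carrier (poly_ring V)"
    then show "\<exists>y\<in>carrier (poly_ring V). y \<oplus>\<^bsub>poly_ring V\<^esub> x = \<zero>\<^bsub>poly_ring V\<^esub>"
      using poly_span_uminus by (intro bexI[of _ "- x"]) auto
  qed (auto simp: poly_span_add ac_simps)
  have "p * q \<in> poly_span (exps V)" if "p \<in> poly_span (exps V)" "q \<in> poly_span (exps V)"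
    for p q :: "'k mpoly"
    using poly_span_mult[OF that] by (simp add: exps_add_self)
  moreover have "1 \<in> (poly_span (exps V) :: 'k mpoly set)"
    by (simp add: poly_span_def)
  ultimately show "comm_monoid (poly_ring V :: 'k mpoly ring)"
    by (intro comm_monoidI) (auto simp: ac_simps)
qed (auto simp: distrib_right)

lemma ideal_poly_span:
  assumes "exp_ideal V E"
  shows "ideal (poly_span E :: 'k::field mpoly set) (poly_ring V)"
proof -
  interpret cring "poly_ring V :: 'k mpoly ring" by (rule cring_poly_ring)
  have sub: "(poly_span E :: 'k mpoly set) \<subseteq> poly_span (exps V)"
    using assms by (intro poly_span_mono) (simp add: exp_ideal_def)
  \<comment> \<open>The inverse in the record structure is given only by the group laws, so it has
    to be identified with negation of polynomials.\<close>
  have minus: "inv\<^bsub>add_monoid (poly_ring V)\<^esub> p = - p" if "p \<in> poly_span (exps V)" for p :: "'k mpoly"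
  proof -
    have "\<ominus>\<^bsub>poly_ring V\<^esub> p = - p"
      using that minus_equality[of "-p" p] poly_span_uminus[OF that] by simp
    then show ?thesis by (simp only: a_inv_def)
  qed
  have mult: "p * q \<in> poly_span E" if "p \<in> poly_span E" "q \<in> poly_span (exps V)" for p q :: "'k mpoly"
    using poly_span_mult[OF that] poly_span_mono[of "E + exps V" E] assms
    unfolding exp_ideal_def by blast
  show ?thesis
  proof (rule idealI)
    show "subgroup (poly_span E :: 'k mpoly set) (add_monoid (poly_ring V))"
      using sub minus
      by (intro subgroup.intro) (auto simp: poly_span_add poly_span_uminus subset_iff)
  qed (use mult ring_axioms in \<open>auto simp: mult.commute\<close>)
qed

text \<open>A polynomial is the finite sum of its terms, and each term is a monomial times a
  constant; constants belong to \<open>poly_ring V\<close> for every \<open>V\<close>.\<close>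

lemma poly_span_subset_ideal:
  assumes L: "ideal L (poly_ring V :: 'k::field mpoly ring)"
    and E: "\<And>a. a \<in> E \<Longrightarrow> Poly_Mapping.single a 1 \<in> L"
  shows "poly_span E \<subseteq> L"
proof
  fix p :: "'k mpoly" assume p: "p \<in> poly_span E"
  interpret ideal L "poly_ring V :: 'k mpoly ring" by (rule L)
  have term_in: "Poly_Mapping.single a c \<in> L" if "a \<in> E" for a c
  proof -
    have "Poly_Mapping.single 0 c * Poly_Mapping.single a 1 \<in> L"
      using I_l_closed[OF E[OF that], of "Poly_Mapping.single 0 c"] by (simp add: single_in_poly_span)
    then show ?thesis by (simp add: mult_single)
  qed
  have "sum f B \<in> L" if "finite B" "\<And>a. a \<in> B \<Longrightarrow> f a \<in> L" for B :: "(nat \<Rightarrow>\<^sub>0 nat) set" and f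
    using that
  proof (induction B rule: finite_induct)
    case empty
    then show ?case using additive_subgroup.zero_closed[OF additive_subgroup_axioms] by simp
  next
    case (insert x B)
    then show ?case using additive_subgroup.a_closed[OF additive_subgroup_axioms, of "f x" "sum f B"] by simp
  qed
  from this[of "Poly_Mapping.keys p" "\<lambda>a. Poly_Mapping.single a (Poly_Mapping.lookup p a)"]
  have "(\<Sum>a\<in>Poly_Mapping.keys p. Poly_Mapping.single a (Poly_Mapping.lookup p a)) \<in> L"
    using p term_in by (auto simp: poly_span_def)
  then show "p \<in> L" by (simp only: poly_span_expand[symmetric])
qed

text \<open>Minimality gives one inclusion; for the other, every monomial of
  \<open>poly_span E\<close> is a multiple of a monomial in \<open>G\<close>. As \<open>G\<close>
  may contain other polynomials too, this serves for monomial generators and for extensions of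
  ideals alike.\<close>

lemma genideal_eq_poly_span:
  fixes G :: "'k::field mpoly set"
  assumes E: "exp_ideal V E" and G: "G \<subseteq> poly_span E"
    and gen: "\<And>a. a \<in> E \<Longrightarrow> \<exists>b. \<exists>c\<in>exps V. a = b + c \<and> Poly_Mapping.single b 1 \<in> G"
  shows "Idl\<^bsub>poly_ring V\<^esub> G = poly_span E"
proof
  interpret cring "poly_ring V :: 'k mpoly ring" by (rule cring_poly_ring)
  show "Idl\<^bsub>poly_ring V\<^esub> G \<subseteq> poly_span E"
    by (intro genideal_minimal ideal_poly_span E G)
  have "G \<subseteq> carrier (poly_ring V)"
    using G E poly_span_mono[of E "exps V"] by (auto simp: exp_ideal_def)
  then have Idl: "ideal (Idl\<^bsub>poly_ring V\<^esub> G) (poly_ring V)" "G \<subseteq> Idl\<^bsub>poly_ring V\<^esub> G"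
    by (rule genideal_ideal, rule genideal_self)
  show "poly_span E \<subseteq> Idl\<^bsub>poly_ring V\<^esub> G"
  proof (rule poly_span_subset_ideal[OF Idl(1)])
    fix a assume "a \<in> E"
    then obtain b c where bc: "c \<in> exps V" "a = b + c" "Poly_Mapping.single b 1 \<in> G"
      using gen by blast
    then have "Poly_Mapping.single b 1 * Poly_Mapping.single c 1 \<in> Idl\<^bsub>poly_ring V\<^esub> G"
      using ideal.I_r_closed[OF Idl(1), of "Poly_Mapping.single b 1" "Poly_Mapping.single c 1"] Idl(2)
      by (auto simp: single_in_poly_span)
    then show "Poly_Mapping.single a 1 \<in> Idl\<^bsub>poly_ring V\<^esub> G"
      by (simp add: bc mult_single)
  qed
qed

lemma exp_ideal_add_exps: "E \<subseteq> exps V \<Longrightarrow> exp_ideal V (E + exps V)"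
  unfolding exp_ideal_def using exps_add_self[of V] by (metis add.assoc order_refl set_plus_mono2)

section \<open>Exponent sets of monomial ideals, of extended ideals and of sums\<close>

lemma monomial_ideal_poly_span:
  fixes I :: "'k::field mpoly set"
  assumes "monomial_ideal V I"
  obtains E where "exp_ideal V E" "I = poly_span E"
proof -
  from assms obtain G where G: "G \<subseteq> monomials V" "I = Idl\<^bsub>poly_ring V\<^esub> G"
    unfolding monomial_ideal_def by blast
  \<comment> \<open>The exponents of the generators only; the exponent set of the ideal is
    \<open>E + exps V\<close>.\<close>
  define E where "E = {a. Poly_Mapping.single a (1::'k) \<in> G}"
  have E: "E \<subseteq> exps V"
  proof
    fix a assume "a \<in> E"
    then obtain b where b: "Poly_Mapping.single a 1 = (Poly_Mapping.single b 1 :: 'k mpoly)" "b \<in> exps V"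
      using G(1) by (auto simp: E_def monomials_def exps_def)
    \<comment> \<open>Since the coefficients are nonzero, comparing supports recovers the exponent
      from the monomial.\<close>
    from b(1) have "Poly_Mapping.keys (Poly_Mapping.single a (1::'k)) = Poly_Mapping.keys (Poly_Mapping.single b (1::'k))"
      by (rule arg_cong)
    with b(2) show "a \<in> exps V" by simp
  qed
  have "I = poly_span (E + exps V)"
    unfolding G(2)
  proof (rule genideal_eq_poly_span)
    show "G \<subseteq> poly_span (E + exps V)"
    proof
      fix p assume "p \<in> G"
      then obtain a where a: "p = Poly_Mapping.single a 1" "a \<in> E"
        using G(1) by (auto simp: E_def monomials_def)
      then have "a + 0 \<in> E + exps V" by (intro set_plus_intro) auto
      then show "p \<in> poly_span (E + exps V)" by (simp add: a(1) single_in_poly_span)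
    qed
  qed (use exp_ideal_add_exps[OF E] in \<open>auto simp: E_def elim!: set_plus_elim\<close>)
  then show thesis using that exp_ideal_add_exps[OF E] by blast
qed

lemma genideal_extension:
  assumes E: "exp_ideal V E" and "V \<subseteq> W"
  shows "Idl\<^bsub>poly_ring W\<^esub> (poly_span E :: 'k::field mpoly set) = poly_span (E + exps W)"
proof (rule genideal_eq_poly_span)
  show "exp_ideal W (E + exps W)"
    using E exps_mono[OF \<open>V \<subseteq> W\<close>] by (intro exp_ideal_add_exps) (auto simp: exp_ideal_def)
  show "(poly_span E :: 'k mpoly set) \<subseteq> poly_span (E + exps W)"
    by (intro poly_span_mono) (metis add.commute set_zero_plus2 zero_in_exps)
  show "\<exists>b. \<exists>c\<in>exps W. a = b + c \<and> Poly_Mapping.single b 1 \<in> (poly_span E :: 'k mpoly set)"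
    if "a \<in> E + exps W" for a
    using that unfolding single_one_in_poly_span_iff by (blast elim: set_plus_elim)
qed

text \<open>A polynomial supported on the union splits into its terms with exponent in
  \<open>E\<close> and the remaining ones, whose exponents must lie in \<open>F\<close>.\<close>

lemma set_add_poly_span:
  "poly_span E <+>\<^bsub>poly_ring V\<^esub> poly_span F = (poly_span (E \<union> F) :: 'k::field mpoly set)"
proof
  show "poly_span E <+>\<^bsub>poly_ring V\<^esub> poly_span F \<subseteq> (poly_span (E \<union> F) :: 'k mpoly set)"
    by (auto simp: set_add_def' poly_span_iff lookup_add)
  show "(poly_span (E \<union> F) :: 'k mpoly set) \<subseteq> poly_span E <+>\<^bsub>poly_ring V\<^esub> poly_span F"
  proof
    fix p :: "'k mpoly" assume p: "p \<in> poly_span (E \<union> F)"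
    have "p = restrict_pm E p + restrict_pm (- E) p"
      by (rule poly_mapping_eqI) (auto simp: lookup_add lookup_restrict_pm when_def)
    moreover have "restrict_pm E p \<in> poly_span E" "restrict_pm (- E) p \<in> poly_span F"
      using p by (auto simp: poly_span_def keys_restrict_pm)
    ultimately show "p \<in> poly_span E <+>\<^bsub>poly_ring V\<^esub> poly_span F"
      unfolding set_add_def' by force
  qed
qed

section \<open>Products and powers on the level of exponents\<close>

lemma exp_ideal_plus:
  assumes "exp_ideal V E" "exp_ideal V F"
  shows "exp_ideal V (E + F)"
proof -
  have "E + F \<subseteq> exps V + exps V" "E + (F + exps V) \<subseteq> E + F"
    using assms unfolding exp_ideal_def by (intro set_plus_mono2; blast)+
  then show ?thesis by (simp add: exp_ideal_def exps_add_self add.assoc)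
qed

text \<open>Products of elements and their sums keep their exponents in \<open>E + F\<close>;
  conversely each monomial with exponent in \<open>E + F\<close> is a product of a monomial from
  each ideal.\<close>

lemma ideal_prod_poly_span:
  assumes "exp_ideal V E" "exp_ideal V F"
  shows "ideal_prod (poly_ring V) (poly_span E) (poly_span F) = (poly_span (E + F) :: 'k::field mpoly set)"
proof
  interpret cring "poly_ring V :: 'k mpoly ring" by (rule cring_poly_ring)
  show "ideal_prod (poly_ring V) (poly_span E) (poly_span F) \<subseteq> (poly_span (E + F) :: 'k mpoly set)"
  proof
    fix p :: "'k mpoly" assume "p \<in> ideal_prod (poly_ring V) (poly_span E) (poly_span F)"
    then show "p \<in> poly_span (E + F)"
      by induction (auto simp: poly_span_mult poly_span_add)
  qed
  show "poly_span (E + F) \<subseteq> ideal_prod (poly_ring V) (poly_span E) (poly_span F :: 'k mpoly set)"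
  proof (rule poly_span_subset_ideal)
    show "ideal (ideal_prod (poly_ring V) (poly_span E) (poly_span F :: 'k mpoly set)) (poly_ring V)"
      by (intro ideal_prod_is_ideal ideal_poly_span assms)
    fix a assume "a \<in> E + F"
    then obtain b c where bc: "a = b + c" "b \<in> E" "c \<in> F" by (rule set_plus_elim)
    then have "Poly_Mapping.single b 1 \<otimes>\<^bsub>poly_ring V\<^esub> Poly_Mapping.single c 1
        \<in> ideal_prod (poly_ring V) (poly_span E) (poly_span F :: 'k mpoly set)"
      by (intro ideal_prod.prod) (auto intro: single_in_poly_span)
    then show "Poly_Mapping.single a 1 \<in> ideal_prod (poly_ring V) (poly_span E) (poly_span F :: 'k mpoly set)"
      by (simp add: bc(1) mult_single)
  qed
qed

text \<open>The base case is \<open>exps V\<close> because the zeroth power of an ideal is the whole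
  ring.\<close>

primrec exp_power :: "nat set \<Rightarrow> (nat \<Rightarrow>\<^sub>0 nat) set \<Rightarrow> nat \<Rightarrow> (nat \<Rightarrow>\<^sub>0 nat) set" where
  "exp_power V E 0 = exps V"
| "exp_power V E (Suc n) = exp_power V E n + E"

lemma exp_ideal_power: "exp_ideal V E \<Longrightarrow> exp_ideal V (exp_power V E n)"
  by (induction n) (simp_all add: exp_ideal_plus, simp add: exp_ideal_def exps_add_self)

lemma ideal_power_poly_span:
  assumes "exp_ideal V E"
  shows "ideal_power (poly_ring V) (poly_span E) n = (poly_span (exp_power V E n) :: 'k::field mpoly set)"
  by (induction n)
    (simp_all add: ideal_power_def nat_pow_def ideals_set_def ideal_prod_poly_span exp_ideal_power assms)

lemma exp_power_Suc_subset:
  assumes "exp_ideal V E"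
  shows "exp_power V E (Suc n) \<subseteq> exp_power V E n"
proof -
  have "exp_power V E n + E \<subseteq> exp_power V E n + exps V"
    using assms by (intro set_plus_mono2) (auto simp: exp_ideal_def)
  then show ?thesis using exp_ideal_power[OF assms, of n] by (auto simp: exp_ideal_def)
qed

lemma exp_power_antimono: "exp_ideal V E \<Longrightarrow> m \<le> n \<Longrightarrow> exp_power V E n \<subseteq> exp_power V E m"
  using lift_Suc_antimono_le[of "exp_power V E" m n] exp_power_Suc_subset by blast

text \<open>
  Without this, the Stanley depths in question could be the unspecified value for the zero module.
\<close>

lemma exp_power_strict:
  assumes "finite V" "exp_ideal V E" "E \<noteq> {}" "0 \<notin> E"
  shows "exp_power V E n - exp_power V E (Suc n) \<noteq> {}"
proof -
  define deg where "deg a = (\<Sum>i\<in>V. Poly_Mapping.lookup a i)" for a :: "nat \<Rightarrow>\<^sub>0 nat"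
  have deg_add: "deg (a + b) = deg a + deg b" for a b
    by (simp add: deg_def lookup_add sum.distrib)
  \<comment> \<open>For \<open>u\<close> of least degree in \<open>E\<close>, the vector
    \<open>n\<close> times \<open>u\<close> lies in the \<open>n\<close>-th power, while every
    element of the next power has degree at least \<open>Suc n * deg u\<close>. This separates the
    two powers once \<open>deg u\<close> is positive.\<close>
  obtain u where u: "u \<in> E" "\<And>a. a \<in> E \<Longrightarrow> deg u \<le> deg a"
    using \<open>E \<noteq> {}\<close> ex_has_least_nat[of "\<lambda>a. a \<in> E" _ deg] by blast
  have "deg u \<noteq> 0"
  proof
    assume "deg u = 0"
    then have "Poly_Mapping.lookup u i = 0" if "i \<in> V" for i
      using that \<open>finite V\<close> by (simp add: deg_def)
    then have "u = 0"
      using u(1) assms(2) unfolding exp_ideal_def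
      by (intro poly_mapping_eqI) (metis in_exps_iff in_mono lookup_zero)
    then show False using u(1) \<open>0 \<notin> E\<close> by simp
  qed
  have lower: "m * deg u \<le> deg a" if "a \<in> exp_power V E m" for a m
    using that
  proof (induction m arbitrary: a)
    case (Suc m)
    then obtain b c where "a = b + c" "b \<in> exp_power V E m" "c \<in> E"
      by (auto elim: set_plus_elim)
    then show ?case using Suc.IH[of b] u(2)[of c] by (simp add: deg_add)
  qed simp
  have "\<exists>a\<in>exp_power V E m. deg a = m * deg u" for m
  proof (induction m)
    case 0
    show ?case by (rule bexI[of _ 0]) (auto simp: deg_def)
  next
    case (Suc m)
    then obtain a where "a \<in> exp_power V E m" "deg a = m * deg u" by blast
    then have "a + u \<in> exp_power V E (Suc m)" "deg (a + u) = Suc m * deg u"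
      using u(1) by (auto simp: deg_add)
    then show ?case by blast
  qed
  then obtain a where "a \<in> exp_power V E n" "deg a = n * deg u" by blast
  moreover have "a \<notin> exp_power V E (Suc n)"
    using lower[of a "Suc n"] calculation \<open>deg u \<noteq> 0\<close> by auto
  ultimately show ?thesis by blast
qed

lemma UN_set_plus: "(\<Union>i\<in>I. X i) + Y = (\<Union>i\<in>I. X i + Y)"
  for Y :: "'a::plus set"
  by (auto simp: set_plus_def)

text \<open>The binomial expansion of a power of \<open>I + J\<close>. Addition of sets distributes
  over unions; a further factor from \<open>E\<close> raises the first exponent and one from
  \<open>F\<close> the second.\<close>

lemma exp_power_sum:
  assumes E: "exp_ideal V E" and F: "exp_ideal W F"
  shows "exp_power (V \<union> W) (E + exps W \<union> (exps V + F)) n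
    = (\<Union>i\<le>n. exp_power V E i + exp_power W F (n - i))"
proof (induction n)
  case 0
  show ?case by (simp add: exps_Un)
next
  case (Suc n)
  define G where "G i j = exp_power V E i + exp_power W F j" for i j
  \<comment> \<open>Lets the factor \<open>exps\<close> contributed by the extension to the other
    block disappear.\<close>
  have absorb: "exp_power V' E' i + exps V' = exp_power V' E' i" if "exp_ideal V' E'" for V' E' i
    using exp_ideal_power[OF that, of i] set_zero_plus2[of "exps V'" "exp_power V' E' i"]
    by (auto simp: exp_ideal_def add.commute)
  have "G i j + (E + exps W) = G (Suc i) j" for i j
  proof -
    have "G i j + (E + exps W) = (exp_power V E i + E) + (exp_power W F j + exps W)"
      unfolding G_def by (simp only: ac_simps)
    then show ?thesis by (simp add: G_def absorb[OF F])
  qed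
  moreover have "G i j + (exps V + F) = G i (Suc j)" for i j
  proof -
    have "G i j + (exps V + F) = (exp_power V E i + exps V) + (exp_power W F j + F)"
      unfolding G_def by (simp only: ac_simps)
    then show ?thesis by (simp add: G_def absorb[OF E])
  qed
  ultimately have step: "G i j + (E + exps W \<union> (exps V + F)) = G (Suc i) j \<union> G i (Suc j)" for i j
    by (simp add: set_plus_Un)
  have "exp_power (V \<union> W) (E + exps W \<union> (exps V + F)) (Suc n)
      = (\<Union>i\<le>n. G i (n - i)) + (E + exps W \<union> (exps V + F))"
    using Suc by (simp add: G_def)
  also have "\<dots> = (\<Union>i\<le>n. G i (n - i) + (E + exps W \<union> (exps V + F)))"
    by (rule UN_set_plus)
  also have "\<dots> = (\<Union>i\<le>n. G (Suc i) (n - i) \<union> G i (Suc (n - i)))"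
    by (simp only: step)
  also have "\<dots> = (\<Union>i\<le>Suc n. G i (Suc n - i))"
  proof (intro subset_antisym subsetI)
    fix x assume "x \<in> (\<Union>i\<le>n. G (Suc i) (n - i) \<union> G i (Suc (n - i)))"
    then obtain i where "i \<le> n" "x \<in> G (Suc i) (Suc n - Suc i) \<or> x \<in> G i (Suc n - i)"
      by (auto simp: Suc_diff_le)
    then show "x \<in> (\<Union>i\<le>Suc n. G i (Suc n - i))"
      by (meson UN_I atMost_iff le_SucI not_less_eq_eq)
  next
    fix x assume "x \<in> (\<Union>i\<le>Suc n. G i (Suc n - i))"
    then obtain i where i: "i \<le> Suc n" "x \<in> G i (Suc n - i)" by blast
    show "x \<in> (\<Union>i\<le>n. G (Suc i) (n - i) \<union> G i (Suc (n - i)))"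
    \<comment> \<open>The top term arises by raising the power of \<open>E\<close>, every other term
      by raising the power of \<open>F\<close>.\<close>
    proof (cases "i = Suc n")
      case True
      then have "x \<in> G (Suc n) (n - n)" using i(2) by simp
      then show ?thesis by blast
    next
      case False
      then have "i \<le> n" "x \<in> G i (Suc (n - i))" using i by (simp_all add: Suc_diff_le)
      then show ?thesis by blast
    qed
  qed
  finally show ?case by (simp add: G_def)
qed

text \<open>The powers decrease, so \<open>a \<in> X i\<close> says that \<open>i\<close> is the
  largest power containing \<open>a\<close>; call it the order of \<open>a\<close>. Orders add up
  under \<open>a + b\<close>, which puts the vectors of order \<open>n\<close> into the sets
  \<open>X i + Y (n - i)\<close>, and uniqueness of the order of \<open>a\<close> makes these
  disjoint.\<close>

lemma exp_power_sum_diff: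
  assumes E: "exp_ideal V E" and F: "exp_ideal W F" and disj: "V \<inter> W = {}"
  defines "X \<equiv> \<lambda>i. exp_power V E i - exp_power V E (Suc i)"
    and "Y \<equiv> \<lambda>j. exp_power W F j - exp_power W F (Suc j)"
    and "H \<equiv> exp_power (V \<union> W) (E + exps W \<union> (exps V + F))"
  shows "H n - H (Suc n) = (\<Union>i\<le>n. X i + Y (n - i))"
    and "disjoint_family_on (\<lambda>i. X i + Y (n - i)) {..n}"
proof -
  have in_V: "a \<in> exps V" if "a \<in> exp_power V E i" for a i
    using that exp_ideal_power[OF E, of i] by (auto simp: exp_ideal_def)
  have in_W: "a \<in> exps W" if "a \<in> exp_power W F i" for a i
    using that exp_ideal_power[OF F, of i] by (auto simp: exp_ideal_def)
  \<comment> \<open>By uniqueness of the splitting, membership of the sum can be tested on the given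
    components \<open>a\<close> and \<open>b\<close>.\<close>
  have H_iff: "a + b \<in> H m \<longleftrightarrow> (\<exists>i\<le>m. a \<in> exp_power V E i \<and> b \<in> exp_power W F (m - i))"
    if ab: "a \<in> exps V" "b \<in> exps W" for a b m
  proof
    assume "a + b \<in> H m"
    then obtain i a' b' where *: "i \<le> m" "a + b = a' + b'" "a' \<in> exp_power V E i"
        "b' \<in> exp_power W F (m - i)"
      unfolding H_def exp_power_sum[OF E F] by (auto elim: set_plus_elim)
    then have "a = a'" "b = b'"
      using exps_add_unique[OF *(2), of V W] ab in_V in_W disj by blast+
    then show "\<exists>i\<le>m. a \<in> exp_power V E i \<and> b \<in> exp_power W F (m - i)" using * by blast
  qed (auto simp: H_def exp_power_sum[OF E F])
  have anti_V: "i \<le> j" if "a \<in> X j" "a \<in> exp_power V E i" for a i j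
    using that exp_power_antimono[OF E, of "Suc j" i] unfolding X_def by (meson DiffD2 in_mono not_less_eq_eq)
  have anti_W: "i \<le> j" if "a \<in> Y j" "a \<in> exp_power W F i" for a i j
    using that exp_power_antimono[OF F, of "Suc j" i] unfolding Y_def by (meson DiffD2 in_mono not_less_eq_eq)
  show "H n - H (Suc n) = (\<Union>i\<le>n. X i + Y (n - i))"
  proof (intro subset_antisym subsetI)
    fix x assume x: "x \<in> H n - H (Suc n)"
    then obtain i a b where iab: "i \<le> n" "x = a + b" "a \<in> exp_power V E i" "b \<in> exp_power W F (n - i)"
      unfolding H_def exp_power_sum[OF E F] by (auto elim: set_plus_elim)
    have nH: "\<not> (\<exists>i\<le>Suc n. a \<in> exp_power V E i \<and> b \<in> exp_power W F (Suc n - i))"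
      using x iab H_iff[of a b "Suc n"] in_V in_W by blast
    \<comment> \<open>If either component lay in the next higher power, \<open>x\<close> would lie
      in \<open>H (Suc n)\<close>. Hence the orders are exactly \<open>i\<close> and
      \<open>n - i\<close>.\<close>
    have "a \<notin> exp_power V E (Suc i)"
      using nH iab by (metis Suc_le_mono diff_Suc_Suc)
    moreover have "b \<notin> exp_power W F (Suc (n - i))"
      using nH iab by (metis Suc_diff_le le_SucI)
    ultimately show "x \<in> (\<Union>i\<le>n. X i + Y (n - i))"
      using iab by (auto simp: X_def Y_def)
  next
    fix x assume "x \<in> (\<Union>i\<le>n. X i + Y (n - i))"
    then obtain i a b where iab: "i \<le> n" "x = a + b" "a \<in> X i" "b \<in> Y (n - i)"
      by (auto elim: set_plus_elim)
    then have ab: "a \<in> exps V" "b \<in> exps W" using in_V in_W by (auto simp: X_def Y_def)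
    have "\<not> (\<exists>j\<le>Suc n. a \<in> exp_power V E j \<and> b \<in> exp_power W F (Suc n - j))"
    proof
      assume "\<exists>j\<le>Suc n. a \<in> exp_power V E j \<and> b \<in> exp_power W F (Suc n - j)"
      then obtain j where "j \<le> Suc n" "a \<in> exp_power V E j" "b \<in> exp_power W F (Suc n - j)" by blast
      \<comment> \<open>Adding the two bounds gives \<open>Suc n \<le> n\<close>.\<close>
      then have "j \<le> i" "Suc n - j \<le> n - i" using anti_V anti_W iab by blast+
      then show False using iab(1) by linarith
    qed
    then show "x \<in> H n - H (Suc n)"
      using H_iff[OF ab] iab by (auto simp: X_def Y_def)
  qed
  have "i \<le> i'"
    if *: "x \<in> X i + Y (n - i)" "x \<in> X i' + Y (n - i')" for i i' x
  proof -
    obtain a b a' b' where ab: "x = a + b" "a \<in> X i" "b \<in> Y (n - i)"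
        "x = a' + b'" "a' \<in> X i'" "b' \<in> Y (n - i')"
      using * by (elim set_plus_elim) blast
    then have "a = a'"
      using exps_add_unique(1)[of a b a' b' V W] in_V in_W disj by (auto simp: X_def Y_def)
    then show ?thesis using anti_V[of a i' i] ab by (auto simp: X_def)
  qed
  then have "i = i'" if "x \<in> X i + Y (n - i)" "x \<in> X i' + Y (n - i')" for i i' x
    using that by (meson order_antisym)
  then show "disjoint_family_on (\<lambda>i. X i + Y (n - i)) {..n}"
    unfolding disjoint_family_on_def by blast
qed

section \<open>Stanley decompositions and cone partitions\<close>

lemma times_single_image:
  assumes "c \<noteq> 0"
  shows "(\<lambda>u. u * Poly_Mapping.single d c) ` poly_span (exps Z) = (poly_span (cone (d, Z)) :: 'k::field mpoly set)"
proof
  show "(\<lambda>u. u * Poly_Mapping.single d c) ` poly_span (exps Z) \<subseteq> (poly_span (cone (d, Z)) :: 'k mpoly set)"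
  proof clarify
    fix u :: "'k mpoly" assume "u \<in> poly_span (exps Z)"
    then have "u * Poly_Mapping.single d c \<in> poly_span (exps Z + {d})"
      by (rule poly_span_mult) (simp add: single_in_poly_span)
    moreover have "exps Z + {d} = cone (d, Z)"
      by (auto simp: cone_def set_plus_def elt_set_plus_def add.commute)
    ultimately show "u * Poly_Mapping.single d c \<in> poly_span (cone (d, Z))" by simp
  qed
  show "(poly_span (cone (d, Z)) :: 'k mpoly set) \<subseteq> (\<lambda>u. u * Poly_Mapping.single d c) ` poly_span (exps Z)"
  proof
    fix p :: "'k mpoly" assume p: "p \<in> poly_span (cone (d, Z))"
    \<comment> \<open>Termwise division by the monomial. Subtraction of exponents is truncated, but
      exact here because every exponent in the cone dominates \<open>d\<close>.\<close>
    define u where "u = (\<Sum>a\<in>Poly_Mapping.keys p. Poly_Mapping.single (a - d) (Poly_Mapping.lookup p a / c))"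
    have a: "a - d + d = a \<and> a - d \<in> exps Z" if "a \<in> Poly_Mapping.keys p" for a
    proof -
      have "a \<in> cone (d, Z)" using p that by (auto simp: poly_span_def)
      then obtain b where "a = d + b" "b \<in> exps Z"
        by (auto simp: cone_def elt_set_plus_def)
      then show ?thesis by (simp add: add.commute)
    qed
    have "u * Poly_Mapping.single d c = (\<Sum>a\<in>Poly_Mapping.keys p. Poly_Mapping.single a (Poly_Mapping.lookup p a))"
      unfolding u_def sum_distrib_right
      by (rule sum.cong) (use a assms in \<open>auto simp: mult_single\<close>)
    then have "p = u * Poly_Mapping.single d c" by (simp only: poly_span_expand[symmetric])
    moreover have "u \<in> poly_span (exps Z)"
      unfolding u_def using a by (intro poly_span_sum single_in_poly_span) blast
    ultimately show "p \<in> (\<lambda>u. u * Poly_Mapping.single d c) ` poly_span (exps Z)" by blast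
  qed
qed

text \<open>Chooses representatives, turning a family of classes into a family of
  polynomials.\<close>

lemma PiE_image_witness:
  fixes X :: "nat \<Rightarrow> 'a set"
  assumes "f \<in> (\<Pi>\<^sub>E i\<in>{..<l}. F ` X i)"
  obtains g where "\<And>i. i < l \<Longrightarrow> f i = F (g i)" "\<And>i. i < l \<Longrightarrow> g i \<in> X i"
proof -
  have "\<forall>i<l. \<exists>x. f i = F x \<and> x \<in> X i"
    using PiE_mem[OF assms] by blast
  then show thesis using that by metis
qed

lemma sdepth_of_decomposition_eq: "sdepth_of_decomposition D = Min (card ` snd ` set D)"
  unfolding sdepth_of_decomposition_def by (rule arg_cong[of _ _ Min]) force

section \<open>The graded module given by a quotient of monomial ideals\<close>

locale monomial_quotient =
  fixes V :: "nat set" and E E' :: "(nat \<Rightarrow>\<^sub>0 nat) set" and L L' :: "'k::field mpoly set"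
  assumes E: "exp_ideal V E" and E': "exp_ideal V E'" and E'_sub: "E' \<subseteq> E"
    and L_eq: "L = poly_span E" and L'_eq: "L' = poly_span E'"
begin

abbreviation "S \<equiv> poly_ring V :: 'k mpoly ring"
abbreviation "M \<equiv> quot_module S L L'"
abbreviation "gr \<equiv> quot_grading S L L'"
abbreviation "cls p \<equiv> L' +>\<^bsub>S\<^esub> p"

lemma L'_ideal: "ideal L' S"
  unfolding L'_eq by (rule ideal_poly_span[OF E'])

lemma L_iff: "p \<in> L \<longleftrightarrow> p \<in> poly_span E" and L'_iff: "p \<in> L' \<longleftrightarrow> p \<in> poly_span E'"
  by (simp_all add: L_eq L'_eq)

lemma in_carrier: "p \<in> L \<Longrightarrow> p \<in> carrier S"
  using E poly_span_mono[of E "exps V"] by (auto simp: exp_ideal_def L_iff)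

lemma cls_eq: "cls p = {q. q - p \<in> L'}"
proof (intro subset_antisym subsetI)
  fix q assume "q \<in> {q. q - p \<in> L'}"
  then show "q \<in> cls p" unfolding a_r_coset_def' by (auto intro!: bexI[of _ "q - p"])
qed (auto simp: a_r_coset_def')

text \<open>A polynomial lies in \<open>L'\<close> exactly if its coefficients vanish outside
  \<open>E'\<close>. Through this, computations with classes become comparisons of
  coefficients.\<close>

lemma cls_eq_iff:
  "cls p = cls q \<longleftrightarrow> (\<forall>a. a \<notin> E' \<longrightarrow> Poly_Mapping.lookup p a = Poly_Mapping.lookup q a)"
proof
  assume "cls p = cls q"
  moreover have "p \<in> cls p" by (simp add: cls_eq L'_iff)
  ultimately have "p - q \<in> L'" by (simp add: cls_eq)
  then show "\<forall>a. a \<notin> E' \<longrightarrow> Poly_Mapping.lookup p a = Poly_Mapping.lookup q a"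
    by (simp add: L'_iff poly_span_iff lookup_minus)
qed (auto simp: cls_eq L'_iff poly_span_iff lookup_minus)

lemma M_simps:
  "carrier M = (\<lambda>p. cls p) ` L" "zero M = cls 0" "add M = set_add S"
  by (simp_all add: quot_module_def cls_eq)

lemma cls_add: "p \<in> L \<Longrightarrow> q \<in> L \<Longrightarrow> cls p \<oplus>\<^bsub>M\<^esub> cls q = cls (p + q)"
  using abelian_subgroup.a_rcos_sum[OF abelian_subgroupI3, of L' S p q] L'_ideal in_carrier
    cring_poly_ring[of V]
  by (simp add: M_simps ideal_def cring_def ring_def)

lemma cls_smult: "u \<in> carrier S \<Longrightarrow> p \<in> L \<Longrightarrow> u \<odot>\<^bsub>M\<^esub> cls p = cls (u * p)"
  using ideal.rcoset_mult_add[OF L'_ideal, of u p] in_carrier by (simp add: quot_module_def)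

lemma abelian_monoid_M: "abelian_monoid M"
proof (rule abelian_monoidI)
  show "\<zero>\<^bsub>M\<^esub> \<in> carrier M" by (auto simp: M_simps L_iff)
qed (auto simp: M_simps(1,2) cls_add L_iff poly_span_add ac_simps)

lemma finsum_cls:
  assumes "finite A" "\<And>i. i \<in> A \<Longrightarrow> g i \<in> L"
  shows "(\<Oplus>\<^bsub>M\<^esub>i\<in>A. cls (g i)) = cls (sum g A)"
proof -
  interpret abelian_monoid M by (rule abelian_monoid_M)
  show ?thesis using assms
  proof (induction A rule: finite_induct)
    case empty
    then show ?case by (simp add: M_simps)
  next
    case (insert x A)
    have "(\<lambda>i. cls (g i)) \<in> A \<rightarrow> carrier M" "cls (g x) \<in> carrier M"
      using insert.prems by (auto simp: M_simps(1))
    moreover have "sum g A \<in> L"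
      using insert.prems by (auto simp: L_iff intro: poly_span_sum)
    ultimately show ?case
      using insert by (simp add: finsum_insert cls_add)
  qed
qed

lemma cls_smult_single:
  assumes "d \<in> E" "Z \<subseteq> V" "u \<in> poly_span (exps Z)"
  shows "u \<odot>\<^bsub>M\<^esub> cls (Poly_Mapping.single d c) = cls (u * Poly_Mapping.single d c)"
  using assms poly_span_mono[OF exps_mono[OF \<open>Z \<subseteq> V\<close>]]
  by (intro cls_smult) (auto simp: L_iff single_in_poly_span)

lemma stanley_space_cls:
  assumes "c \<noteq> 0" "d \<in> E" "Z \<subseteq> V"
  shows "stanley_space M (cls (Poly_Mapping.single d c)) Z = (\<lambda>p. cls p) ` poly_span (cone (d, Z))"
  using cls_smult_single[OF assms(2,3)]
  unfolding stanley_space_def times_single_image[OF assms(1), symmetric] by auto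

text \<open>Freeness means that no monomial multiple of the generator dies in the quotient. If
  \<open>b + d \<in> E'\<close>, the monomial with exponent \<open>b\<close> is sent to the same
  class as \<open>0\<close>; otherwise the coefficient of \<open>u\<close> at \<open>b\<close> is
  recovered from the one at \<open>b + d\<close>, as \<open>c\<close> is nonzero.\<close>

lemma inj_on_smult_iff:
  assumes "c \<noteq> 0" "d \<in> E" "Z \<subseteq> V"
  shows "inj_on (\<lambda>u. u \<odot>\<^bsub>M\<^esub> cls (Poly_Mapping.single d c)) (carrier (poly_ring Z)) \<longleftrightarrow>
    cone (d, Z) \<inter> E' = {}"
proof -
  note smult = cls_smult_single[OF assms(2,3)]
  show ?thesis
  proof
    assume inj: "inj_on (\<lambda>u. u \<odot>\<^bsub>M\<^esub> cls (Poly_Mapping.single d c)) (carrier (poly_ring Z))"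
    have "b + d \<notin> E'" if b: "b \<in> exps Z" for b
    proof
      assume "b + d \<in> E'"
      then have "cls (Poly_Mapping.single b 1 * Poly_Mapping.single d c) = cls (0 * Poly_Mapping.single d c)"
        unfolding cls_eq_iff by (auto simp: mult_single lookup_single when_def)
      then have "Poly_Mapping.single b (1::'k) = 0"
        using inj b smult[of 0] smult[of "Poly_Mapping.single b 1"]
        by (intro inj_onD[OF inj]) (auto simp: single_in_poly_span)
      then show False by (metis lookup_single_eq lookup_zero one_neq_zero)
    qed
    then show "cone (d, Z) \<inter> E' = {}"
      by (auto simp: cone_def elt_set_plus_def add.commute)
  next
    assume disj: "cone (d, Z) \<inter> E' = {}"
    show "inj_on (\<lambda>u. u \<odot>\<^bsub>M\<^esub> cls (Poly_Mapping.single d c)) (carrier (poly_ring Z))"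
    proof (rule inj_onI)
      fix u v :: "'k mpoly"
      assume uv: "u \<in> carrier (poly_ring Z)" "v \<in> carrier (poly_ring Z)"
        and eq: "u \<odot>\<^bsub>M\<^esub> cls (Poly_Mapping.single d c) = v \<odot>\<^bsub>M\<^esub> cls (Poly_Mapping.single d c)"
      have cls: "cls (u * Poly_Mapping.single d c) = cls (v * Poly_Mapping.single d c)"
        using eq smult uv by simp
      have "Poly_Mapping.lookup u b = Poly_Mapping.lookup v b" for b
      proof (cases "b \<in> exps Z")
        case True
        then have "b + d \<in> cone (d, Z)" by (auto simp: cone_def elt_set_plus_def add.commute)
        then have "b + d \<notin> E'" using disj by blast
        then show ?thesis
          using cls \<open>c \<noteq> 0\<close> by (metis cls_eq_iff lookup_times_single mult_right_cancel)
      qed (use uv in \<open>auto simp: poly_span_iff\<close>)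
      then show "u = v" by (rule poly_mapping_eqI)
    qed
  qed
qed

text \<open>Testing on the class of a single monomial, uniqueness of representations yields
  disjointness and existence yields covering. Conversely, cutting \<open>p\<close> down to each
  \<open>C i\<close> gives the only possible family.\<close>

lemma direct_sum_iff:
  fixes C :: "nat \<Rightarrow> (nat \<Rightarrow>\<^sub>0 nat) set"
  assumes C: "\<And>i. i < l \<Longrightarrow> C i \<subseteq> E - E'"
  shows "(\<forall>x\<in>carrier M. \<exists>!f. f \<in> (\<Pi>\<^sub>E i\<in>{..<l}. (\<lambda>p. cls p) ` poly_span (C i)) \<and>
      x = (\<Oplus>\<^bsub>M\<^esub>i\<in>{..<l}. f i)) \<longleftrightarrow>
    disjoint_family_on C {..<l} \<and> (\<Union>i<l. C i) = E - E'"
    (is "(\<forall>x\<in>carrier M. \<exists>!f. ?P x f) \<longleftrightarrow> _")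
proof -
  have C_sub: "p \<in> L" if "p \<in> poly_span (C i)" "i < l" for p :: "'k mpoly" and i
    using that C[of i] poly_span_mono[of "C i" E] by (auto simp: L_iff)
  have finsum: "(\<Oplus>\<^bsub>M\<^esub>i\<in>{..<l}. f i) = cls (\<Sum>i<l. g i)"
    if "\<And>i. i < l \<Longrightarrow> f i = cls (g i)" "\<And>i. i < l \<Longrightarrow> g i \<in> poly_span (C i)" for f g
  proof -
    have g: "g i \<in> L" if "i < l" for i
      using \<open>\<And>i. i < l \<Longrightarrow> g i \<in> poly_span (C i)\<close>[OF that] that by (rule C_sub)
    then have "(\<Oplus>\<^bsub>M\<^esub>i\<in>{..<l}. f i) = (\<Oplus>\<^bsub>M\<^esub>i\<in>{..<l}. cls (g i))"
      using that(1)
      by (intro abelian_monoid.finsum_cong'[OF abelian_monoid_M]) (auto simp: M_simps(1))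
    then show ?thesis using finsum_cls[of "{..<l}" g] g by simp
  qed
  show ?thesis
  proof
    assume unique: "\<forall>x\<in>carrier M. \<exists>!f. ?P x f"
    have cls_single: "cls (Poly_Mapping.single a 1) \<in> carrier M" if "a \<in> E" for a
      using that by (auto simp: M_simps(1) L_iff single_in_poly_span)
    have "C i \<inter> C j = {}" if ij: "i < l" "j < l" "i \<noteq> j" for i j
    proof (rule ccontr)
      assume "C i \<inter> C j \<noteq> {}"
      then obtain a where a: "a \<in> C i" "a \<in> C j" by blast
      \<comment> \<open>Two competing representations of the same class: the whole monomial is
        placed into summand \<open>k\<close>, for \<open>k = i\<close> and for
        \<open>k = j\<close>.\<close>
      define g where "g k m = (if m = k then Poly_Mapping.single a (1::'k) else 0)" for k m :: nat
      define f where "f k = (\<lambda>m\<in>{..<l}. cls (g k m))" for k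
      have P: "?P (cls (Poly_Mapping.single a 1)) (f k)" if k: "k = i \<or> k = j" for k
      proof
        have g: "g k m \<in> poly_span (C m)" for m
          using k a by (auto simp: g_def single_in_poly_span)
        then show "f k \<in> (\<Pi>\<^sub>E i\<in>{..<l}. (\<lambda>p. cls p) ` poly_span (C i))"
          by (auto simp: f_def)
        have "(\<Sum>m<l. g k m) = Poly_Mapping.single a 1"
          using k ij by (auto simp: g_def)
        then show "cls (Poly_Mapping.single a 1) = (\<Oplus>\<^bsub>M\<^esub>i\<in>{..<l}. f k i)"
          using finsum[of "f k" "g k"] g by (simp add: f_def)
      qed
      have "a \<in> E - E'" using C ij a by blast
      then have "\<exists>!f. ?P (cls (Poly_Mapping.single a 1)) f"
        by (intro bspec[OF unique] cls_single) simp
      from the1_equality[OF this, OF P[of i, OF disjI1[OF refl]]]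
        the1_equality[OF this, OF P[of j, OF disjI2[OF refl]]]
      have "f i = f j" by (rule trans[OF sym])
      then have "cls (g i i) = cls (g j i)" using ij(1) by (metis f_def lessThan_iff restrict_apply')
      then show False
        using \<open>a \<in> E - E'\<close> ij(3) unfolding cls_eq_iff g_def by (auto dest!: spec[of _ a])
    qed
    moreover have "a \<in> (\<Union>i<l. C i)" if a: "a \<in> E - E'" for a
    proof -
      have "\<exists>!f. ?P (cls (Poly_Mapping.single a 1)) f"
        using a by (intro bspec[OF unique] cls_single) simp
      then obtain f where f: "?P (cls (Poly_Mapping.single a 1)) f"
        by (rule ex1_implies_ex[THEN exE])
      obtain g where g: "\<And>i. i < l \<Longrightarrow> f i = cls (g i)" "\<And>i. i < l \<Longrightarrow> g i \<in> poly_span (C i)"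
        using conjunct1[OF f] by (rule PiE_image_witness) blast
      then have "cls (Poly_Mapping.single a 1) = cls (\<Sum>i<l. g i)"
        using f finsum[of f g] by simp
      \<comment> \<open>As \<open>a\<close> is outside \<open>E'\<close>, its coefficient is
        determined by the class, so some summand must contain \<open>a\<close>.\<close>
      then have "(\<Sum>i<l. Poly_Mapping.lookup (g i) a) = 1"
        using a unfolding cls_eq_iff by (metis DiffD2 lookup_single_eq lookup_sum)
      then obtain i where "i < l" "Poly_Mapping.lookup (g i) a \<noteq> 0"
        by (metis lessThan_iff sum.neutral zero_neq_one)
      then show ?thesis using g(2) by (auto simp: poly_span_iff)
    qed
    moreover have "(\<Union>i<l. C i) \<subseteq> E - E'" by (intro UN_least C) simp
    ultimately show "disjoint_family_on C {..<l} \<and> (\<Union>i<l. C i) = E - E'"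
      unfolding disjoint_family_on_def by (intro conjI subset_antisym) auto
  next
    assume "disjoint_family_on C {..<l} \<and> (\<Union>i<l. C i) = E - E'"
    then have disj: "\<And>i j. i < l \<Longrightarrow> j < l \<Longrightarrow> i \<noteq> j \<Longrightarrow> C i \<inter> C j = {}"
      and cover: "(\<Union>i<l. C i) = E - E'"
      by (auto simp: disjoint_family_on_def)
    have lookup_sum_C: "Poly_Mapping.lookup (\<Sum>j<l. g j) a = Poly_Mapping.lookup (g i) a"
      if "i < l" "a \<in> C i" "\<And>j. j < l \<Longrightarrow> g j \<in> poly_span (C j)" for g :: "nat \<Rightarrow> 'k mpoly" and i a
    proof -
      have "Poly_Mapping.lookup (g j) a = 0" if "j < l" "j \<noteq> i" for j
        using that disj[of i j] \<open>\<And>j. j < l \<Longrightarrow> g j \<in> poly_span (C j)\<close>[of j] \<open>i < l\<close> \<open>a \<in> C i\<close>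
        by (auto simp: poly_span_iff)
      then have "(\<Sum>j<l. Poly_Mapping.lookup (g j) a) = (\<Sum>j\<in>{i}. Poly_Mapping.lookup (g j) a)"
        using \<open>i < l\<close> by (intro sum.mono_neutral_right) auto
      then show ?thesis by (simp add: lookup_sum)
    qed
    show "\<forall>x\<in>carrier M. \<exists>!f. ?P x f"
    proof
      fix x assume "x \<in> carrier M"
      then obtain p where p: "p \<in> L" "x = cls p" by (auto simp: M_simps(1))
      define g where "g i = restrict_pm (C i) p" for i
      define f where "f = (\<lambda>i\<in>{..<l}. cls (g i))"
      have g: "g i \<in> poly_span (C i)" for i
        by (simp add: g_def poly_span_def keys_restrict_pm)
      have "Poly_Mapping.lookup (\<Sum>i<l. g i) a = Poly_Mapping.lookup p a" if "a \<notin> E'" for a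
      proof (cases "a \<in> E")
        case True
        then have "a \<in> (\<Union>i<l. C i)" using cover that by blast
        then obtain i where "i < l" "a \<in> C i" by blast
        then show ?thesis using lookup_sum_C[of i a g] g by (simp add: g_def lookup_restrict_pm)
      next
        case False
        then have "Poly_Mapping.lookup p a = 0" using p(1) by (simp add: L_iff poly_span_iff)
        then show ?thesis by (simp add: lookup_sum g_def lookup_restrict_pm)
      qed
      then have "cls p = cls (\<Sum>i<l. g i)" by (simp add: cls_eq_iff)
      then have Pf: "?P x f" using finsum[of f g] g p by (auto simp: f_def)
      moreover have "f' = f" if f': "?P x f'" for f'
      proof (rule PiE_ext[OF conjunct1[OF f'] conjunct1[OF Pf]])
        obtain g' where g': "\<And>i. i < l \<Longrightarrow> f' i = cls (g' i)" "\<And>i. i < l \<Longrightarrow> g' i \<in> poly_span (C i)"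
          using conjunct1[OF f'] by (rule PiE_image_witness) blast
        then have eq: "cls p = cls (\<Sum>i<l. g' i)" using f' finsum[of f' g'] p by simp
        fix i assume i: "i \<in> {..<l}"
        \<comment> \<open>Even the representatives agree: both are supported on \<open>C i\<close>,
          which misses \<open>E'\<close>, so their coefficients are determined by the class of
          \<open>p\<close>.\<close>
        have "g' i = g i"
        proof (rule poly_mapping_eqI)
          fix a
          show "Poly_Mapping.lookup (g' i) a = Poly_Mapping.lookup (g i) a"
          proof (cases "a \<in> C i")
            case True
            moreover have "a \<notin> E'" using True C i by blast
            ultimately have "Poly_Mapping.lookup p a = Poly_Mapping.lookup (g' i) a"
              using eq lookup_sum_C[of i a g'] g' i unfolding cls_eq_iff by auto
            then show ?thesis using True by (simp add: g_def lookup_restrict_pm)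
          qed (use g' g i in \<open>auto simp: poly_span_iff\<close>)
        qed
        then show "f' i = f i" using g' i by (simp add: f_def)
      qed
      ultimately show "\<exists>!f. ?P x f" by (rule ex1I)
    qed
  qed
qed

section \<open>Translation between Stanley decompositions and cone partitions\<close>

text \<open>Each homogeneous generator is the class of one nonzero term, whose exponent becomes the
  apex of a cone. Keeping the same variable sets is what transfers the depth.\<close>

lemma stanley_to_cone_partition:
  assumes D: "stanley_decomposition V M gr D"
  obtains P where "cone_partition V (E - E') P" "snd ` P = snd ` set D"
proof -
  define l where "l = length D"
  have "\<exists>d c. c \<noteq> 0 \<and> d \<in> E \<and> m = cls (Poly_Mapping.single d c) \<and> Z \<subseteq> V \<and> cone (d, Z) \<inter> E' = {}"
    if "(m, Z) \<in> set D" for m Z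
  proof -
    have mZ: "homogeneous V gr m" "Z \<subseteq> V"
      "inj_on (\<lambda>u. u \<odot>\<^bsub>M\<^esub> m) (carrier (poly_ring Z))"
      using D that unfolding stanley_decomposition_def by blast+
    obtain e p where p: "m = cls p" "p \<in> L"
      "\<And>a i. a \<in> Poly_Mapping.keys p \<Longrightarrow> int (Poly_Mapping.lookup a i) = Poly_Mapping.lookup e i"
      using mZ(1) unfolding homogeneous_def quot_grading_def by blast
    \<comment> \<open>A zero generator would give \<open>0\<close> and \<open>1\<close> the same
      multiple, contradicting freeness.\<close>
    have "p \<noteq> 0"
    proof
      assume "p = 0"
      then have "0 \<odot>\<^bsub>M\<^esub> m = 1 \<odot>\<^bsub>M\<^esub> m"
        using cls_smult[of 0 0] cls_smult[of 1 0] p by (simp add: poly_span_def)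
      then have "0 = (1 :: 'k mpoly)"
        by (intro inj_onD[OF mZ(3)]) (auto simp: poly_span_def)
      then show False by simp
    qed
    then obtain d where d: "d \<in> Poly_Mapping.keys p" by (metis keys_eq_empty equals0I)
    define c where "c = Poly_Mapping.lookup p d"
    \<comment> \<open>All exponents of \<open>p\<close> agree with the integer degree
      \<open>e\<close>, so only one can occur.\<close>
    have "a = d" if "a \<in> Poly_Mapping.keys p" for a
      using p(3)[OF that] p(3)[OF d] by (intro poly_mapping_eqI) (metis of_nat_eq_iff)
    then have "p = Poly_Mapping.single d c"
      by (intro poly_mapping_eqI) (auto simp: c_def lookup_single when_def in_keys_iff)
    moreover have "c \<noteq> 0" "d \<in> E"
      using d p(2) by (auto simp: c_def in_keys_iff L_iff poly_span_def)
    ultimately show ?thesis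
      using mZ p inj_on_smult_iff by blast
  qed
  then have "\<forall>i<l. \<exists>d c. c \<noteq> 0 \<and> d \<in> E \<and> fst (D ! i) = cls (Poly_Mapping.single d c) \<and>
      snd (D ! i) \<subseteq> V \<and> cone (d, snd (D ! i)) \<inter> E' = {}"
    unfolding l_def by (metis nth_mem prod.collapse)
  then obtain d c where dc: "\<And>i. i < l \<Longrightarrow> c i \<noteq> 0 \<and> d i \<in> E \<and> fst (D ! i) = cls (Poly_Mapping.single (d i) (c i)) \<and>
      snd (D ! i) \<subseteq> V \<and> cone (d i, snd (D ! i)) \<inter> E' = {}"
    by metis
  define C where "C i = cone (d i, snd (D ! i))" for i
  have space: "stanley_space M (fst (D ! i)) (snd (D ! i)) = (\<lambda>p. cls p) ` poly_span (C i)" if "i < l" for i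
    using stanley_space_cls dc[OF that] by (simp add: C_def)
  have C_sub: "C i \<subseteq> E - E'" if "i < l" for i
  proof -
    have "exps (snd (D ! i)) \<subseteq> exps V" using dc[OF that] by (intro exps_mono) simp
    then have "C i \<subseteq> E"
      using dc[OF that] exp_ideal_add[OF E] by (auto simp: C_def cone_def elt_set_plus_def)
    then show ?thesis using dc[OF that] by (auto simp: C_def)
  qed
  have Pi_eq: "(\<Pi>\<^sub>E i\<in>{..<l}. stanley_space M (fst (D ! i)) (snd (D ! i)))
      = (\<Pi>\<^sub>E i\<in>{..<l}. (\<lambda>p. cls p) ` poly_span (C i))"
    by (intro PiE_cong space) simp
  have "\<forall>x\<in>carrier M. \<exists>!f. f \<in> (\<Pi>\<^sub>E i\<in>{..<l}. (\<lambda>p. cls p) ` poly_span (C i)) \<and>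
      x = (\<Oplus>\<^bsub>M\<^esub>i\<in>{..<l}. f i)"
    using D unfolding stanley_decomposition_def Pi_eq l_def[symmetric] by (rule conjunct2)
  then have "disjoint_family_on C {..<l} \<and> (\<Union>i<l. C i) = E - E'"
    by (rule direct_sum_iff[THEN iffD1, rotated]) (rule C_sub)
  then have C: "disjoint_family_on C {..<l}" "(\<Union>i<l. C i) = E - E'" by simp_all
  define P where "P = (\<lambda>i. (d i, snd (D ! i))) ` {..<l}"
  have "disjoint_family_on cone P"
    unfolding disjoint_family_on_def
  proof (intro ballI impI)
    fix x y assume "x \<in> P" "y \<in> P" "x \<noteq> y"
    then obtain i j where "i < l" "j < l" "i \<noteq> j" "cone x = C i" "cone y = C j"
      by (auto simp: P_def C_def)
    then show "cone x \<inter> cone y = {}" using C(1) by (auto simp: disjoint_family_on_def)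
  qed
  then have "cone_partition V (E - E') P"
    using C(2) dc by (auto simp: cone_partition_def P_def C_def)
  moreover have "snd ` P = snd ` set D"
    by (force simp: P_def l_def set_conv_nth)
  ultimately show thesis by (rule that)
qed

lemma cone_partition_to_stanley:
  assumes P: "cone_partition V (E - E') P"
  obtains D where "stanley_decomposition V M gr D" "snd ` P = snd ` set D"
proof -
  obtain xs where xs: "set xs = P" "distinct xs"
    using finite_distinct_list[OF cone_partitionD(1)[OF P]] by blast
  define D where "D = map (\<lambda>(d, Z). (cls (Poly_Mapping.single d 1), Z)) xs"
  define C where "C i = cone (xs ! i)" for i
  have xs_in: "xs ! i \<in> P" if "i < length xs" for i using xs that by auto
  note cone_sub = cone_partitionD(3)[OF P]
  have P_prop: "fst x \<in> E" "snd x \<subseteq> V" "cone x \<inter> E' = {}" if "x \<in> P" for x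
    using cone_sub[OF that] fst_in_cone[of x] cone_partitionD(2)[OF P that] by blast+
  have nth: "D ! i = (cls (Poly_Mapping.single (fst (xs ! i)) 1), snd (xs ! i))" if "i < length xs" for i
    using that by (simp add: D_def case_prod_beta)
  have len: "length D = length xs" by (simp add: D_def)
  have space: "stanley_space M (fst (D ! i)) (snd (D ! i)) = (\<lambda>p. cls p) ` poly_span (C i)"
    if "i < length xs" for i
    using stanley_space_cls[of 1 "fst (xs ! i)" "snd (xs ! i)"] P_prop[OF xs_in[OF that]] nth[OF that]
    by (simp add: C_def)
  have Pi_eq: "(\<Pi>\<^sub>E i\<in>{..<length xs}. stanley_space M (fst (D ! i)) (snd (D ! i)))
      = (\<Pi>\<^sub>E i\<in>{..<length xs}. (\<lambda>p. cls p) ` poly_span (C i))"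
    by (intro PiE_cong space) simp
  have "disjoint_family_on C {..<length xs}"
    unfolding disjoint_family_on_def
  proof (intro ballI impI)
    fix i j assume "i \<in> {..<length xs}" "j \<in> {..<length xs}" "i \<noteq> j"
    then have "xs ! i \<noteq> xs ! j" "xs ! i \<in> P" "xs ! j \<in> P"
      using xs(2) xs_in by (auto simp: nth_eq_iff_index_eq)
    then show "C i \<inter> C j = {}"
      unfolding C_def by (intro cone_partitionD(4)[OF P])
  qed
  moreover have "(\<Union>i<length xs. C i) = E - E'"
  proof -
    have "(\<Union>i<length xs. C i) = (\<Union>x\<in>set xs. cone x)"
      by (force simp: C_def in_set_conv_nth)
    then show ?thesis using cone_partitionD(5)[OF P] xs(1) by simp
  qed
  moreover have "C i \<subseteq> E - E'" if "i < length xs" for i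
    using cone_sub[OF xs_in[OF that]] by (simp add: C_def)
  ultimately have direct: "\<forall>x\<in>carrier M. \<exists>!f. f \<in> (\<Pi>\<^sub>E i\<in>{..<length xs}. (\<lambda>p. cls p) ` poly_span (C i)) \<and>
      x = (\<Oplus>\<^bsub>M\<^esub>i\<in>{..<length xs}. f i)"
    by (intro direct_sum_iff[THEN iffD2] conjI)
  have "m \<in> carrier M \<and> homogeneous V gr m \<and> Z \<subseteq> V \<and>
      inj_on (\<lambda>u. u \<odot>\<^bsub>M\<^esub> m) (carrier (poly_ring Z))" if mZ: "(m, Z) \<in> set D" for m Z
  proof -
    obtain d where d: "m = cls (Poly_Mapping.single d 1)" "(d, Z) \<in> P"
      using mZ xs(1) by (auto simp: D_def)
    have dE: "d \<in> E" "Z \<subseteq> V" "cone (d, Z) \<inter> E' = {}" using P_prop[OF d(2)] by auto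
    then have single_in: "Poly_Mapping.single d 1 \<in> L" by (simp add: L_iff single_in_poly_span)
    \<comment> \<open>Degrees are integer vectors, so the degree of the generator is
      \<open>d\<close> read in the integers.\<close>
    define e where "e = Poly_Mapping.map int d"
    have e: "Poly_Mapping.lookup e i = int (Poly_Mapping.lookup d i)" for i
      by (simp add: e_def Poly_Mapping.map.rep_eq when_def)
    have "d \<in> exps V" using dE(1) E by (auto simp: exp_ideal_def)
    then have "Poly_Mapping.keys e \<subseteq> V" by (auto simp: exps_def in_keys_iff e)
    moreover have "m \<in> gr e"
      unfolding quot_grading_def d(1) using single_in e by fastforce
    ultimately have "homogeneous V gr m" unfolding homogeneous_def by blast
    then show ?thesis
      using dE single_in inj_on_smult_iff[of 1 d Z] d(1) by (auto simp: M_simps(1))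
  qed
  then have "stanley_decomposition V M gr D"
    unfolding stanley_decomposition_def len Pi_eq by (intro conjI direct) auto
  moreover have "snd ` P = snd ` set D"
    by (simp add: D_def xs(1)[symmetric] image_image case_prod_beta)
  ultimately show thesis by (rule that)
qed

text \<open>The two translations preserve the variable sets, so both maxima are taken over the same
  set of numbers.\<close>

lemma sdepth_quot_eq: "sdepth_quot V L L' = partition_sdepth V (E - E')"
proof -
  have "{sdepth_of_decomposition D | D. stanley_decomposition V M gr D}
      = {Min (card ` snd ` P) | P. cone_partition V (E - E') P}"
    unfolding sdepth_of_decomposition_eq
    by (intro subset_antisym subsetI; clarify)
      (metis stanley_to_cone_partition, metis cone_partition_to_stanley)
  then show ?thesis by (simp add: sdepth_quot_def sdepth_def partition_sdepth_def)
qed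

end

section \<open>Powers of a sum\<close>

text \<open>Optimal partitions for the pairs \<open>(i, n - i)\<close> are combined by adding cones
  and collected over all \<open>i\<close>. Since the blocks are disjoint, the numbers of variables
  of two added cones add up, so \<open>bound\<close> applies to each resulting cone.\<close>

lemma partition_sdepth_power_sum:
  assumes fin: "finite V" "finite W" and disj: "V \<inter> W = {}"
    and E: "exp_ideal V E" "E \<noteq> {}" "0 \<notin> E" and F: "exp_ideal W F" "F \<noteq> {}" "0 \<notin> F"
    and bound: "\<And>i. i \<le> n \<Longrightarrow> k \<le> partition_sdepth V (exp_power V E i - exp_power V E (Suc i))
      + partition_sdepth W (exp_power W F (n - i) - exp_power W F (Suc (n - i)))"
  defines "H \<equiv> exp_power (V \<union> W) (E + exps W \<union> (exps V + F))"
  shows "k \<le> partition_sdepth (V \<union> W) (H n - H (Suc n))"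
proof -
  define X where "X i = exp_power V E i - exp_power V E (Suc i)" for i
  define Y where "Y j = exp_power W F j - exp_power W F (Suc j)" for j
  have X_sub: "X i \<subseteq> exps V" and Y_sub: "Y i \<subseteq> exps W" for i
    using exp_ideal_power[OF E(1), of i] exp_ideal_power[OF F(1), of i]
    by (auto simp: X_def Y_def exp_ideal_def)
  have nonempty: "X i \<noteq> {}" "Y i \<noteq> {}" for i
    unfolding X_def Y_def by (intro exp_power_strict fin E F)+
  have "\<exists>P. cone_partition V (X i) P \<and> (\<forall>c\<in>P. partition_sdepth V (X i) \<le> card (snd c))" for i
    using partition_sdepth_attained[OF fin(1) nonempty(1)]
      cone_partition_exists[OF fin(1) exp_ideal_power[OF E(1)] exp_ideal_power[OF E(1)]]
    unfolding X_def by metis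
  then obtain P where P: "\<And>i. cone_partition V (X i) (P i)"
      "\<And>i c. c \<in> P i \<Longrightarrow> partition_sdepth V (X i) \<le> card (snd c)"
    by metis
  have "\<exists>Q. cone_partition W (Y j) Q \<and> (\<forall>c\<in>Q. partition_sdepth W (Y j) \<le> card (snd c))" for j
    using partition_sdepth_attained[OF fin(2) nonempty(2)]
      cone_partition_exists[OF fin(2) exp_ideal_power[OF F(1)] exp_ideal_power[OF F(1)]]
    unfolding Y_def by metis
  then obtain Q where Q: "\<And>j. cone_partition W (Y j) (Q j)"
      "\<And>j c. c \<in> Q j \<Longrightarrow> partition_sdepth W (Y j) \<le> card (snd c)"
    by metis
  define T where "T i = (\<lambda>(c, c'). (fst c + fst c', snd c \<union> snd c')) ` (P i \<times> Q (n - i))" for i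
  have diff: "H n - H (Suc n) = (\<Union>i\<le>n. X i + Y (n - i))"
    and fam: "disjoint_family_on (\<lambda>i. X i + Y (n - i)) {..n}"
    using exp_power_sum_diff[OF E(1) F(1) disj, of n] by (simp_all only: H_def X_def Y_def)
  show ?thesis
  proof (rule partition_sdepth_ge)
    show "finite (V \<union> W)" using fin by simp
    show "H n - H (Suc n) \<noteq> {}"
    proof -
      obtain a b where "a \<in> X n" "b \<in> Y (n - n)" using nonempty by blast
      then have "a + b \<in> X n + Y (n - n)" by (rule set_plus_intro)
      then show ?thesis unfolding diff by blast
    qed
    have "cone_partition (V \<union> W) (X i + Y (n - i)) (T i)" for i
      unfolding T_def by (intro cone_partition_plus P Q X_sub Y_sub disj)
    then show "cone_partition (V \<union> W) (H n - H (Suc n)) (\<Union>i\<le>n. T i)"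
      unfolding diff using fam by (intro cone_partition_UN) auto
    fix t assume "t \<in> (\<Union>i\<le>n. T i)"
    then obtain i c c' where t: "i \<le> n" "c \<in> P i" "c' \<in> Q (n - i)" "snd t = snd c \<union> snd c'"
      by (auto simp: T_def)
    have sub: "snd c \<subseteq> V" "snd c' \<subseteq> W"
      using cone_partitionD(2) P(1) Q(1) t(2,3) by blast+
    have "k \<le> partition_sdepth V (X i) + partition_sdepth W (Y (n - i))"
      using bound[OF t(1)] by (simp only: X_def Y_def)
    also have "\<dots> \<le> card (snd c) + card (snd c')"
      by (intro add_mono P Q t)
    also have "\<dots> = card (snd t)"
      unfolding t(4) using sub disj fin by (intro card_Un_disjoint[symmetric]) (auto dest: finite_subset)
    finally show "k \<le> card (snd t)" .
  qed
qed

lemma sdepth_quot_ideal_power: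
  fixes I :: "'k::field mpoly set"
  assumes E: "exp_ideal V E" and I: "I = poly_span E"
  shows "sdepth_quot V (ideal_power (poly_ring V) I n) (ideal_power (poly_ring V) I (Suc n))
    = partition_sdepth V (exp_power V E n - exp_power V E (Suc n))"
proof -
  interpret monomial_quotient V "exp_power V E n" "exp_power V E (Suc n)"
    "ideal_power (poly_ring V) I n" "ideal_power (poly_ring V) I (Suc n)"
    by unfold_locales (simp_all only: I ideal_power_poly_span E exp_ideal_power exp_power_Suc_subset)
  show ?thesis by (rule sdepth_quot_eq)
qed

text \<open>Extension adds all exponents on \<open>V \<union> W\<close>, but \<open>E\<close>
  already absorbs those on \<open>V\<close> and \<open>F\<close> those on \<open>W\<close>, leaving
  the form used in the binomial expansion.\<close>

lemma extended_sum_poly_span: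
  assumes E: "exp_ideal V E" and F: "exp_ideal W F"
  shows "extended_sum (poly_ring (V \<union> W)) (poly_span E) (poly_span F)
      = (poly_span (E + exps W \<union> (exps V + F)) :: 'k::field mpoly set)"
    and "exp_ideal (V \<union> W) (E + exps W \<union> (exps V + F))"
proof -
  have absorb: "E + exps V = E" "F + exps W = F"
    using E F set_zero_plus2[of "exps V" E] set_zero_plus2[of "exps W" F]
    by (auto simp: exp_ideal_def add.commute)
  have *: "E + exps (V \<union> W) = E + exps W" "F + exps (V \<union> W) = exps V + F"
    by (simp only: exps_Un absorb flip: add.assoc)
      (simp only: exps_Un absorb add.left_commute[of F])
  show "extended_sum (poly_ring (V \<union> W)) (poly_span E) (poly_span F)
      = (poly_span (E + exps W \<union> (exps V + F)) :: 'k mpoly set)"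
    unfolding extended_sum_def genideal_extension[OF E Un_upper1] genideal_extension[OF F Un_upper2]
      set_add_poly_span * ..
  have "exp_ideal (V \<union> W) (E + exps (V \<union> W))" "exp_ideal (V \<union> W) (F + exps (V \<union> W))"
    using E F exps_mono[of V "V \<union> W"] exps_mono[of W "V \<union> W"]
    by (auto simp: exp_ideal_def intro!: exp_ideal_add_exps[unfolded exp_ideal_def])
  then show "exp_ideal (V \<union> W) (E + exps W \<union> (exps V + F))"
    unfolding * exp_ideal_def by (simp add: Un_set_plus le_supI1 le_supI2)
qed

text \<open>An empty \<open>E\<close> would give the zero ideal, and \<open>0 \<in> E\<close> would
  put the unit, hence the whole ring, into the ideal.\<close>

lemma proper_monomial_ideal:
  fixes I :: "'k::field mpoly set"
  assumes "monomial_ideal V I" "I \<noteq> {\<zero>\<^bsub>poly_ring V\<^esub>}" "I \<noteq> carrier (poly_ring V)"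
  obtains E where "exp_ideal V E" "I = poly_span E" "E \<noteq> {}" "0 \<notin> E"
proof -
  obtain E where E: "exp_ideal V E" "I = poly_span E"
    using assms(1) by (rule monomial_ideal_poly_span)
  have "poly_span {} = {0 :: 'k mpoly}" by (auto simp: poly_span_def)
  then have "E \<noteq> {}" using assms(2) E(2) by auto
  moreover have "0 \<notin> E"
  proof
    assume "0 \<in> E"
    then have "exps V \<subseteq> E" using exp_ideal_add[OF E(1), of 0] by auto
    then have "E = exps V" using E(1) by (simp add: exp_ideal_def subset_antisym)
    then show False using assms(3) E(2) by simp
  qed
  ultimately show thesis using that E by blast
qed

theorem proposition2p4:
  fixes A B R :: "'k::field mpoly ring"
    and I J :: "'k mpoly set"
    and r s n :: nat
  assumes "r \<ge> 1" and "s \<ge> 1"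
    and "A = poly_ring {1..r}"
    and "B = poly_ring {r+1..r+s}"
    and "R = poly_ring {1..r+s}"
    and "monomial_ideal {1..r} I" and "I \<noteq> {\<zero>\<^bsub>A\<^esub>}" and "I \<noteq> carrier A"
    and "monomial_ideal {r+1..r+s} J" and "J \<noteq> {\<zero>\<^bsub>B\<^esub>}" and "J \<noteq> carrier B"
  shows "sdepth_quot {1..r+s}
           (ideal_power R (extended_sum R I J) n)
           (ideal_power R (extended_sum R I J) (n + 1))
         \<ge> Min {sdepth_quot {1..r} (ideal_power A I i) (ideal_power A I (i + 1)) +
                sdepth_quot {r+1..r+s} (ideal_power B J j) (ideal_power B J (j + 1)) | i j.
                i + j = n}"
proof -
  define V where "V = {1..r}"
  define W where "W = {r+1..r+s}"
  have VW: "{1..r+s} = V \<union> W" "V \<inter> W = {}" "finite V" "finite W"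
    by (auto simp: V_def W_def)
  have A: "A = poly_ring V" and B: "B = poly_ring W" and R: "R = poly_ring (V \<union> W)"
    using assms(3-5) VW(1) by (simp_all add: V_def W_def)
  obtain E where E: "exp_ideal V E" "I = poly_span E" "E \<noteq> {}" "0 \<notin> E"
    using assms(6-8) unfolding A V_def[symmetric] by (rule proper_monomial_ideal)
  obtain F where F: "exp_ideal W F" "J = poly_span F" "F \<noteq> {}" "0 \<notin> F"
    using assms(9-11) unfolding B W_def[symmetric] by (rule proper_monomial_ideal)
  define a where "a i = sdepth_quot V (ideal_power A I i) (ideal_power A I (Suc i))" for i
  define b where "b j = sdepth_quot W (ideal_power B J j) (ideal_power B J (Suc j))" for j
  have a: "a i = partition_sdepth V (exp_power V E i - exp_power V E (Suc i))" for i
    unfolding a_def A by (rule sdepth_quot_ideal_power[OF E(1,2)])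
  have b: "b j = partition_sdepth W (exp_power W F j - exp_power W F (Suc j))" for j
    unfolding b_def B by (rule sdepth_quot_ideal_power[OF F(1,2)])
  have "finite {a i + b j | i j. i + j = n}"
    by (rule finite_subset[of _ "(\<lambda>(i, j). a i + b j) ` ({..n} \<times> {..n})"]) auto
  \<comment> \<open>Each index \<open>i \<le> n\<close> gives the admissible pair
    \<open>(i, n - i)\<close>, so the minimum supplies the bound at every \<open>i\<close>.\<close>
  then have "Min {a i + b j | i j. i + j = n} \<le> a i + b (n - i)" if "i \<le> n" for i
    using le_add_diff_inverse[OF that] by (intro Min_le) blast+
  then have "Min {a i + b j | i j. i + j = n}
      \<le> partition_sdepth (V \<union> W) (exp_power (V \<union> W) (E + exps W \<union> (exps V + F)) n
        - exp_power (V \<union> W) (E + exps W \<union> (exps V + F)) (Suc n))"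
    unfolding a b using VW E F by (intro partition_sdepth_power_sum) auto
  also have "\<dots> = sdepth_quot (V \<union> W) (ideal_power R (extended_sum R I J) n)
      (ideal_power R (extended_sum R I J) (Suc n))"
    unfolding R using E F
    by (intro sdepth_quot_ideal_power[symmetric]) (simp_all add: extended_sum_poly_span)
  finally show ?thesis
    unfolding VW(1) a_def b_def V_def W_def by simp
qed

end
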